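(* Let $G$ be a locally countable Borel graph of bounded degree on a standard Borel space $X$, and let $k\in\mathbb{N}$. Then there is a Borel orientation $o$ of $G$ such that for every $G$-quasi-invariant Borel probability measure $\mu$ on $X$ with Radon–Nikodym cocycle $\rho(\cdot,\cdot)$ and $\rho:=\sup_{x,y}\rho(x,y)$: if $k>\rho^2\alpha_\mu(G)$, then \[\mu(\{x\in X: \operatorname{out}_o(x)>k\})=0.\]
   Context: A graph $G$ on $X$ is a symmetric subset of $X^2$; $G_x=\{y:(x,y)\in G\}$. An orientation of $G$ is a relation $o\subseteq X^2$ such that $\{x,y\}\in G$ iff $(x,y)\in o$ or $(y,x)\in o$; $\operatorname{out}_o(x)=|o_x|$ where $o_x=\{y:(x,y)\in o\}$. A Borel probability measure $\mu$ on $X$ is $G$-quasi-invariant if it admits a Radon–Nikodym cocycle, i.e. a function $\rho:X^2\to\mathbb{R}^+$ such that for every Borel partial injection $f$ whose graph is contained in $G$ and every Borel $A\subseteq X$, $\mu(f[A])=\int_{A}\rho(x,f(x))\,d\mu$. For such $\mu$, \[\alpha_\mu(G)=\sup\Big\{\frac{1}{2\mu(A)}\int_{x\in A}|G_x\cap A|\,d\mu : A\subseteq X \text{ Borel},\ \mu(A)>0\Big\}.\]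
   Formalization: The graph G is additionally assumed to have no loops; with loops the claim fails, e.g. for the complete graph on four vertices minus an edge with a loop at each vertex, uniform measure, ρ = 1 and k = 2. *)

theory Defs
  imports "HOL-Probability.Probability"
begin

text \<open>A measurable space is given by a term of type \<open>'a measure\<close>, of which only the carrier
  and the sigma-algebra are used.\<close>

definition standard_borel_space :: "'a measure \<Rightarrow> bool" where
  "standard_borel_space X \<longleftrightarrow>
    (\<exists>T. completely_metrizable_space T \<and> separable_space T \<and> topspace T = space X \<and>
         sets X = sigma_sets (space X) {U. openin T U})"

text \<open>Irreflexivity is essential: for the complete graph on four vertices with one edge
  removed and a loop added at each vertex, any orientation has nine arcs, hence a vertex of
  out-degree above 2, whereas the uniform measure has trivial cocycle and
  \<open>\<alpha> = 14/8 < 2\<close>.\<close>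

definition borel_graph :: "'a measure \<Rightarrow> ('a \<times> 'a) set \<Rightarrow> bool" where
  "borel_graph X G \<longleftrightarrow> G \<in> sets (X \<Otimes>\<^sub>M X) \<and> sym G \<and> irrefl G"

definition locally_countable :: "'a measure \<Rightarrow> ('a \<times> 'a) set \<Rightarrow> bool" where
  "locally_countable X G \<longleftrightarrow> (\<forall>x\<in>space X. countable (G `` {x}))"

definition bounded_degree :: "'a measure \<Rightarrow> ('a \<times> 'a) set \<Rightarrow> bool" where
  "bounded_degree X G \<longleftrightarrow>
    (\<exists>d::nat. \<forall>x\<in>space X. finite (G `` {x}) \<and> card (G `` {x}) \<le> d)"

text \<open>An edge may be oriented in both directions.\<close>

definition orientation :: "'a measure \<Rightarrow> ('a \<times> 'a) set \<Rightarrow> ('a \<times> 'a) set \<Rightarrow> bool" where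
  "orientation X G r \<longleftrightarrow> r \<subseteq> space X \<times> space X \<and>
    (\<forall>x\<in>space X. \<forall>y\<in>space X. (x, y) \<in> G \<longleftrightarrow> (x, y) \<in> r \<or> (y, x) \<in> r)"

definition borel_orientation :: "'a measure \<Rightarrow> ('a \<times> 'a) set \<Rightarrow> ('a \<times> 'a) set \<Rightarrow> bool" where
  "borel_orientation X G r \<longleftrightarrow> orientation X G r \<and> r \<in> sets (X \<Otimes>\<^sub>M X)"

text \<open>Cardinality with value \<open>\<infinity>\<close> (rather than 0) on infinite sets.\<close>

definition ecount :: "'a set \<Rightarrow> ennreal" where
  "ecount S = emeasure (count_space UNIV) S"

definition out_degree :: "('a \<times> 'a) set \<Rightarrow> 'a \<Rightarrow> ennreal" where
  "out_degree r x = ecount (r `` {x})"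

definition borel_probability :: "'a measure \<Rightarrow> 'a measure \<Rightarrow> bool" where
  "borel_probability X \<mu> \<longleftrightarrow> prob_space \<mu> \<and> sets \<mu> = sets X"

text \<open>A partial injection is a total function together with its domain \<open>D\<close>; values off \<open>D\<close>
  are irrelevant.\<close>

definition borel_partial_injection :: "'a measure \<Rightarrow> 'a set \<Rightarrow> ('a \<Rightarrow> 'a) \<Rightarrow> bool" where
  "borel_partial_injection X D f \<longleftrightarrow>
    D \<in> sets X \<and> f \<in> restrict_space X D \<rightarrow>\<^sub>M X \<and> inj_on f D"

text \<open>The only measurability asked of \<open>\<rho>\<close> is that the integrands \<open>\<rho>(x, f(x))\<close> are Borel.\<close>

definition radon_nikodym_cocycle ::
  "'a measure \<Rightarrow> ('a \<times> 'a) set \<Rightarrow> 'a measure \<Rightarrow> ('a \<Rightarrow> 'a \<Rightarrow> real) \<Rightarrow> bool" where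
  "radon_nikodym_cocycle X G \<mu> \<rho> \<longleftrightarrow>
    (\<forall>x\<in>space X. \<forall>y\<in>space X. 0 < \<rho> x y) \<and>
    (\<forall>D f. borel_partial_injection X D f \<and> (\<forall>x\<in>D. (x, f x) \<in> G) \<longrightarrow>
       (\<lambda>x. \<rho> x (f x)) \<in> borel_measurable (restrict_space X D) \<and>
       (\<forall>A\<in>sets X. A \<subseteq> D \<longrightarrow>
          emeasure \<mu> (f ` A) = (\<integral>\<^sup>+x\<in>A. ennreal (\<rho> x (f x)) \<partial>\<mu>)))"

definition quasi_invariant :: "'a measure \<Rightarrow> ('a \<times> 'a) set \<Rightarrow> 'a measure \<Rightarrow> bool" where
  "quasi_invariant X G \<mu> \<longleftrightarrow> (\<exists>\<rho>. radon_nikodym_cocycle X G \<mu> \<rho>)"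

definition cocycle_sup :: "'a measure \<Rightarrow> ('a \<Rightarrow> 'a \<Rightarrow> real) \<Rightarrow> ennreal" where
  "cocycle_sup X \<rho> = (SUP x\<in>space X. SUP y\<in>space X. ennreal (\<rho> x y))"

definition alpha :: "'a measure \<Rightarrow> ('a \<times> 'a) set \<Rightarrow> 'a measure \<Rightarrow> ennreal" where
  "alpha X G \<mu> =
    (SUP A\<in>{A\<in>sets X. 0 < emeasure \<mu> A}.
       (\<integral>\<^sup>+x\<in>A. ecount (G `` {x} \<inter> A) \<partial>\<mu>) / (2 * emeasure \<mu> A))"

end

theory Submission
  imports Defs
begin

text \<open>Starting from any Borel orientation, stage \<open>n\<close> reverses augmenting walks of length at most \<open>n\<close>,
  from vertices of out-degree above \<open>k\<close> to vertices of out-degree below \<open>k\<close>, until none is left.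
  Write \<open>C\<close> for the supremum of the cocycle. If no augmenting walk of length at most \<open>n\<close> exists,
  all vertices reachable in at most \<open>n\<close> steps from the overfull set have out-degree at least \<open>k\<close>;
  comparing with \<open>\<alpha>\<close>, each step multiplies the measure by at least \<open>k / (C \<alpha>)\<close>, so the
  overfull set has measure at most \<open>(C \<alpha> / k) ^ n\<close>. Each overfull vertex starts boundedly many
  walks, and the \<open>l\<close>-th vertices of walks carry at most \<open>C ^ l\<close> times the measure of the starting
  points, so stage \<open>n\<close> alters a set of measure of order \<open>n (C\<^sup>2 \<alpha> / k) ^ n\<close>. This is
  summable when \<open>k > C\<^sup>2 \<alpha>\<close>, and by Borel--Cantelli the upper limit of the orientations works for
  all such measures at once.

  Measurability rests on the Lusin--Novikov theorem for sections of bounded size. It follows from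
  Lusin separation by induction on the size: a clopen set and its complement split each section
  with at least two points into smaller ones on some Borel set.\<close>

section \<open>Analytic sets and Lusin separation\<close>

text \<open>The orientation must be Borel and chosen before any measure is known. Augmenting walks
  can be reversed neither one at a time along a well-order nor all at once, since walks that share
  vertices interfere. The way out is a countable list of moves, each a word in the partial
  injections together with a colouring and a list of distinct colours. All walks of one move are
  pairwise disjoint and are reversed simultaneously. Each reversal lowers the excess of out-degree
  over \<open>k\<close> at the start and raises it nowhere, so within one stage every vertex is
  altered finitely often, although every move recurs infinitely often. The decomposition of
  \<open>G\<close> into partial injections serves twice: images of Borel sets under them are Borel,
  and the cocycle speaks only about such maps. The square of \<open>C\<close> has two sources: one
  factor arises when in-arcs are traded for out-arcs in the growth estimate, the other when the mass
  of starting points is carried along the reversed walks.\<close>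

instantiation nat :: metric_space
begin

text \<open>Distinct naturals lie at distance at least 1, so this metric induces the discrete
  topology that \<open>nat\<close> already carries. Through it \<open>baire\<close> and its products
  are metric spaces, as \<open>analytic_open\<close> and \<open>analytic_borel\<close>
  require.\<close>

definition dist_nat :: "nat \<Rightarrow> nat \<Rightarrow> real" where
  "dist_nat m n = \<bar>real m - real n\<bar>"

definition uniformity_nat :: "(nat \<times> nat) filter" where
  "uniformity_nat = (INF e\<in>{0<..}. principal {(x, y). dist x y < e})"

instance
proof
  fix U :: "nat set"
  have dist_less_1: "\<bar>real m - real n\<bar> < 1 \<Longrightarrow> m = n" for m n by linarith
  have "\<forall>\<^sub>F (x', y) in uniformity. x' = x \<longrightarrow> y \<in> U" if "x \<in> U" for x
    unfolding uniformity_nat_def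
    by (rule eventually_INF1[of 1])
      (use that in \<open>auto simp: eventually_principal dist_nat_def dest: dist_less_1\<close>)
  then show "open U = (\<forall>x\<in>U. \<forall>\<^sub>F (x', y) in uniformity. x' = x \<longrightarrow> y \<in> U)"
    by (simp add: Topological_Spaces.open_discrete)
qed (auto simp: dist_nat_def uniformity_nat_def)

end

type_synonym baire = "nat \<Rightarrow> nat"

definition analytic :: "'a::topological_space set \<Rightarrow> bool" where
  "analytic A \<longleftrightarrow> (\<exists>K::('a \<times> baire) set. closed K \<and> A = fst ` K)"

lemma analyticI: "closed (K::('a::topological_space \<times> baire) set) \<Longrightarrow> A = fst ` K \<Longrightarrow> analytic A"
  unfolding analytic_def by blast

lemma continuous_on_baire_eval: "continuous_on S (\<lambda>p::'a::topological_space \<times> baire. snd p i)"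
  by (rule continuous_on_product_then_coordinatewise) (intro continuous_intros)

lemma continuous_on_baire_reindex:
  "continuous_on S (\<lambda>p::'a::topological_space \<times> baire. (fst p, \<lambda>i. snd p (h i)))"
  by (intro continuous_intros continuous_on_baire_eval)

text \<open>Entry 0 of a witness names the index and its tail is a witness for that index. Demanding
  for every \<open>n\<close> that entry 0 differs from \<open>n\<close> or the tail lies in
  \<open>K n\<close> presents this as an intersection of closed sets.\<close>

lemma analytic_UN:
  assumes "\<And>n::nat. analytic (A n :: 'a::topological_space set)"
  shows "analytic (\<Union>n. A n)"
proof -
  obtain K where K: "\<And>n. closed (K n)" "\<And>n. A n = fst ` (K n :: ('a \<times> baire) set)"
    using assms unfolding analytic_def by metis
  define L :: "('a \<times> baire) set" where
    "L = (\<Inter>n. (\<lambda>p. snd p 0) -` (- {n}) \<union> (\<lambda>p. (fst p, \<lambda>i. snd p (Suc i))) -` K n)"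
  have "closed L"
    unfolding L_def
    by (intro closed_INT ballI closed_Un closed_vimage K continuous_on_baire_eval
        continuous_on_baire_reindex) (simp_all add: closed_def Topological_Spaces.open_discrete)
  moreover have "(\<Union>n. A n) = fst ` L"
  proof (intro equalityI subsetI)
    fix x assume "x \<in> (\<Union>n. A n)"
    then obtain n z where "(x, z) \<in> K n" using K(2) by auto
    then have "(x, case_nat n z) \<in> L" by (auto simp: L_def)
    then show "x \<in> fst ` L" by force
  next
    fix x assume "x \<in> fst ` L"
    then obtain z where "(x, z) \<in> L" by force
    then have "(x, \<lambda>i. z (Suc i)) \<in> K (z 0)" by (auto simp: L_def)
    then show "x \<in> (\<Union>n. A n)" using K(2) by force
  qed
  ultimately show ?thesis by (rule analyticI)
qed

text \<open>One sequence carries a witness for every \<open>n\<close> at once, in the columns given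
  by \<open>prod_encode\<close>.\<close>

lemma analytic_INT:
  assumes "\<And>n::nat. analytic (A n :: 'a::topological_space set)"
  shows "analytic (\<Inter>n. A n)"
proof -
  obtain K where K: "\<And>n. closed (K n)" "\<And>n. A n = fst ` (K n :: ('a \<times> baire) set)"
    using assms unfolding analytic_def by metis
  define L :: "('a \<times> baire) set" where
    "L = (\<Inter>n. (\<lambda>p. (fst p, \<lambda>i. snd p (prod_encode (n, i)))) -` K n)"
  have "closed L"
    unfolding L_def
    by (intro closed_INT ballI closed_vimage K continuous_on_baire_reindex)
  moreover have "(\<Inter>n. A n) = fst ` L"
  proof (intro equalityI subsetI)
    fix x assume "x \<in> (\<Inter>n. A n)"
    then have "\<forall>n. \<exists>z. (x, z) \<in> K n" using K(2) by force
    then obtain z where "\<And>n. (x, z n) \<in> K n" by metis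
    then have "(x, \<lambda>j. case prod_decode j of (n, i) \<Rightarrow> z n i) \<in> L" by (auto simp: L_def)
    then show "x \<in> fst ` L" by force
  next
    fix x assume "x \<in> fst ` L"
    then obtain z where z: "(x, z) \<in> L" by force
    have "x \<in> A n" for n
    proof -
      have "(x, \<lambda>i. z (prod_encode (n, i))) \<in> K n" using z by (auto simp: L_def)
      then show ?thesis using K(2) by force
    qed
    then show "x \<in> (\<Inter>n. A n)" by blast
  qed
  ultimately show ?thesis by (rule analyticI)
qed

lemma analytic_Un:
  assumes "analytic A" "analytic B" shows "analytic (A \<union> B)"
proof -
  have "analytic (\<Union>n. if n = (0::nat) then A else B)"
    using assms by (intro analytic_UN) auto
  also have "(\<Union>n. if n = (0::nat) then A else B) = A \<union> B" by (auto split: if_splits)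
  finally show ?thesis .
qed

lemma analytic_Int:
  assumes "analytic A" "analytic B" shows "analytic (A \<inter> B)"
proof -
  have "analytic (\<Inter>n. if n = (0::nat) then A else B)"
    using assms by (intro analytic_INT) auto
  also have "(\<Inter>n. if n = (0::nat) then A else B) = A \<inter> B"
    by (auto split: if_splits)
  finally show ?thesis .
qed

text \<open>The projected coordinate and the old witness are interleaved on the even and odd
  positions of one new witness.\<close>

lemma analytic_fst_image:
  assumes "analytic (B :: ('a::topological_space \<times> baire) set)"
  shows "analytic (fst ` B)"
proof -
  obtain K :: "(('a \<times> baire) \<times> baire) set" where K: "closed K" "B = fst ` K"
    using assms unfolding analytic_def by blast
  define L :: "('a \<times> baire) set" where
    "L = (\<lambda>p. ((fst p, \<lambda>i. snd p (2 * i)), \<lambda>i. snd p (2 * i + 1))) -` K"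
  have "closed L"
    unfolding L_def
    by (intro closed_vimage K continuous_intros continuous_on_baire_eval)
  moreover have "fst ` B = fst ` L"
  proof (intro equalityI subsetI)
    fix x assume "x \<in> fst ` B"
    then obtain y z where "((x, y), z) \<in> K" using K(2) by force
    then have "(x, \<lambda>j. if even j then y (j div 2) else z (j div 2)) \<in> L" by (auto simp: L_def)
    then show "x \<in> fst ` L" by force
  next
    fix x assume "x \<in> fst ` L"
    then obtain w where "((x, \<lambda>i. w (2 * i)), \<lambda>i. w (2 * i + 1)) \<in> K" by (auto simp: L_def)
    then show "x \<in> fst ` B" using K(2) by force
  qed
  ultimately show ?thesis by (rule analyticI)
qed

lemma analytic_closed:
  assumes "closed (A :: 'a::topological_space set)" shows "analytic A"
proof (rule analyticI)
  show "closed (fst -` A :: ('a \<times> baire) set)"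
    using assms by (intro closed_vimage continuous_intros)
  show "A = fst ` (fst -` A :: ('a \<times> baire) set)" by force
qed

text \<open>In a metric space an open set is the countable union of the closed sets of points at
  distance at least \<open>1/(n+1)\<close> from the complement. The whole space is separate because
  \<open>infdist\<close> to the empty set is 0.\<close>

lemma analytic_open:
  assumes "open (A :: 'a::metric_space set)" shows "analytic A"
proof (cases "A = UNIV")
  case False
  have "analytic (\<Union>n::nat. {x. infdist x (- A) \<ge> inverse (Suc n)})"
    by (intro analytic_UN analytic_closed closed_Collect_le continuous_intros)
  also have "(\<Union>n::nat. {x. infdist x (- A) \<ge> inverse (Suc n)}) = A" (is "?L = _")
  proof (intro equalityI subsetI)
    fix x assume "x \<in> ?L"
    then obtain n where "infdist x (- A) \<ge> inverse (real (Suc n))" by blast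
    moreover have "inverse (real (Suc n)) > 0" by simp
    ultimately have "infdist x (- A) \<noteq> 0" by linarith
    then show "x \<in> A" by (metis infdist_zero ComplI)
  next
    fix x assume "x \<in> A"
    then have "infdist x (- A) > 0"
      using assms False
      by (metis ComplD Compl_UNIV_eq compl_eq_compl_iff closed_Compl infdist_pos_not_in_closed)
    then show "x \<in> ?L" using reals_Archimedean less_imp_le by blast
  qed
  finally show ?thesis .
qed (simp add: analytic_closed)

text \<open>Analytic sets are not closed under complement, so the induction carries each set
  together with its complement.\<close>

lemma analytic_borel:
  assumes "A \<in> sets (borel :: 'a::metric_space measure)" shows "analytic A"
proof -
  have "A \<in> sigma_sets UNIV (Collect closed)"
    using assms by (simp add: borel_eq_closed)
  then have "analytic A \<and> analytic (- A)"
  proof induction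
    case (Basic a)
    then show ?case by (auto intro: analytic_closed analytic_open)
  next
    case Empty
    then show ?case by (auto intro: analytic_closed)
  next
    case (Compl a)
    then show ?case by (simp add: Compl_eq_Diff_UNIV[symmetric])
  next
    case (Union a)
    then show ?case by (auto simp: Compl_UN intro: analytic_UN analytic_INT)
  qed
  then show ?thesis ..
qed

text \<open>Points of \<open>K\<close> that match longer and longer prefixes of
  \<open>(x, z)\<close> converge to it in the product topology.\<close>

lemma closed_baire_approx:
  fixes K :: "(baire \<times> baire) set"
  assumes "closed K" and app: "\<And>n. \<exists>p\<in>K. \<forall>i<n. fst p i = x i \<and> snd p i = z i"
  shows "(x, z) \<in> K"
proof -
  obtain p where p: "\<And>n. p n \<in> K" "\<And>n i. i < n \<Longrightarrow> fst (p n) i = x i \<and> snd (p n) i = z i"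
    using app by metis
  have lim: "f \<longlonglongrightarrow> l" if "\<And>n i. i < n \<Longrightarrow> f n i = l i" for f :: "nat \<Rightarrow> baire" and l
  proof -
    have "limitin (product_topology (\<lambda>_. euclidean) UNIV) f l sequentially"
      unfolding limitin_componentwise
    proof (intro conjI ballI)
      fix i :: nat
      have "\<forall>\<^sub>F n in sequentially. l i = f n i"
        using eventually_gt_at_top[of i] by eventually_elim (simp add: that)
      then show "limitin euclidean (\<lambda>n. f n i) (l i) sequentially"
        by (simp add: tendsto_eventually eq_commute)
    qed auto
    then show ?thesis by (simp add: euclidean_product_topology)
  qed
  have "(\<lambda>n. (fst (p n), snd (p n))) \<longlonglongrightarrow> (x, z)"
    by (intro tendsto_Pair lim) (use p(2) in auto)
  then show ?thesis
    using closed_sequentially[OF \<open>closed K\<close>, of p] p(1) by simp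
qed

section \<open>Separation of analytic sets by Borel sets\<close>

definition separable_by_borel :: "baire set \<Rightarrow> baire set \<Rightarrow> bool" where
  "separable_by_borel P Q \<longleftrightarrow> (\<exists>C\<in>sets borel. P \<subseteq> C \<and> C \<inter> Q = {})"

text \<open>Used contrapositively: if two countable unions are inseparable, so is some pair of their
  pieces. This is what lets \<open>lusin_separation\<close> descend along prefixes.\<close>

lemma separable_by_borel_UN:
  assumes "\<And>m n. separable_by_borel (P m) (Q n)"
  shows "separable_by_borel (\<Union>m::'b::countable. P m) (\<Union>n::'c::countable. Q n)"
proof -
  obtain C where C: "\<And>m n. C m n \<in> sets borel" "\<And>m n. P m \<subseteq> C m n" "\<And>m n. C m n \<inter> Q n = {}"
    using assms unfolding separable_by_borel_def by metis
  have "(\<Union>m. \<Inter>n. C m n) \<in> sets borel"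
    by (intro sets.countable_UN'' sets.countable_INT'' C) auto
  moreover have "(\<Union>m. P m) \<subseteq> (\<Union>m. \<Inter>n. C m n)" using C(2) by blast
  moreover have "(\<Union>m. \<Inter>n. C m n) \<inter> (\<Union>n. Q n) = {}" using C(3) by blast
  ultimately show ?thesis unfolding separable_by_borel_def by blast
qed

text \<open>From an inseparable pair, splitting both witness sets by longer and longer prefixes
  always leaves an inseparable pair of pieces. The prefixes determine a point of \<open>K\<close>
  and a point of \<open>K'\<close>. Their first components differ at some entry because
  \<open>A\<close> and \<open>A'\<close> are disjoint, and prescribing that entry is a Borel
  separation of pieces chosen to be inseparable.\<close>

theorem lusin_separation:
  fixes A A' :: "baire set"
  assumes "analytic A" "analytic A'" "A \<inter> A' = {}"
  shows "\<exists>C\<in>sets borel. A \<subseteq> C \<and> C \<inter> A' = {}"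
proof (rule ccontr)
  assume "\<not> ?thesis"
  then have nonsep: "\<not> separable_by_borel A A'" unfolding separable_by_borel_def by blast
  obtain K K' :: "(baire \<times> baire) set"
    where K: "closed K" "A = fst ` K" and K': "closed K'" "A' = fst ` K'"
    using assms unfolding analytic_def by blast
  \<comment> \<open>The list \<open>s\<close> prescribes initial entries of the point and of its
    witness simultaneously, as pairs.\<close>
  define cut where "cut L s =
    {p \<in> L. \<forall>i<length s. fst p i = fst (s ! i) \<and> snd p i = snd (s ! i)}"
    for L :: "(baire \<times> baire) set" and s
  have cut_split: "fst ` cut L s = (\<Union>e. fst ` cut L (s @ [e]))" for L s
  proof -
    have "cut L s = (\<Union>e. cut L (s @ [e]))"
      by (auto simp: cut_def nth_append less_Suc_eq)
    then show ?thesis by (simp add: image_UN)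
  qed
  define bad where "bad n u \<longleftrightarrow> length (fst u) = n \<and> length (snd u) = n \<and>
    \<not> separable_by_borel (fst ` cut K (fst u)) (fst ` cut K' (snd u))" for n u
  define ext where "ext u v \<longleftrightarrow> (\<exists>e e'. v = (fst u @ [e], snd u @ [e']))"
    for u v :: "(nat \<times> nat) list \<times> (nat \<times> nat) list"
  have "\<exists>S. \<forall>n. bad n (S n) \<and> ext (S n) (S (Suc n))"
  proof (rule dependent_nat_choice)
    show "\<exists>u. bad 0 u"
      using nonsep K K' by (intro exI[of _ "([], [])"]) (simp add: bad_def cut_def)
    fix u n assume "bad n u"
    have "\<exists>e e'. \<not> separable_by_borel (fst ` cut K (fst u @ [e])) (fst ` cut K' (snd u @ [e']))"
    proof (rule ccontr)
      assume "\<not> ?thesis"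
      then have "separable_by_borel (\<Union>e. fst ` cut K (fst u @ [e])) (\<Union>e. fst ` cut K' (snd u @ [e]))"
        by (intro separable_by_borel_UN) (metis (no_types))
      then show False
        using \<open>bad n u\<close> unfolding bad_def cut_split[symmetric] by simp
    qed
    then obtain e e' where
      "\<not> separable_by_borel (fst ` cut K (fst u @ [e])) (fst ` cut K' (snd u @ [e']))"
      by blast
    then show "\<exists>v. bad (Suc n) v \<and> ext u v"
      using \<open>bad n u\<close> unfolding bad_def ext_def
      by (intro exI[of _ "(fst u @ [e], snd u @ [e'])"]) auto
  qed
  then obtain S where S: "\<And>n. bad n (S n)" "\<And>n. ext (S n) (S (Suc n))" by blast
  define s where "s i = fst (S (Suc i)) ! i" for i
  define s' where "s' i = snd (S (Suc i)) ! i" for i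
  have len: "length (fst (S n)) = n" "length (snd (S n)) = n" for n
    using S(1) unfolding bad_def by auto
  have nth: "fst (S n) ! i = s i \<and> snd (S n) ! i = s' i" if "i < n" for i n
    using that
  proof (induction n)
    case (Suc n)
    obtain e e' where e: "S (Suc n) = (fst (S n) @ [e], snd (S n) @ [e'])"
      using S(2)[of n] unfolding ext_def by blast
    show ?case
    proof (cases "i = n")
      case True
      then show ?thesis by (simp add: s_def s'_def)
    next
      case False
      then show ?thesis using Suc e len by (simp add: nth_append)
    qed
  qed simp
  \<comment> \<open>The empty set is separable from everything, so inseparable pieces supply the
    approximants for \<open>closed_baire_approx\<close>.\<close>
  have nonempty: "cut K (fst (S n)) \<noteq> {}" "cut K' (snd (S n)) \<noteq> {}" for n
  proof -
    have "separable_by_borel {} Q" "separable_by_borel Q {}" for Q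
      unfolding separable_by_borel_def by (auto intro: bexI[of _ "{}"] bexI[of _ UNIV])
    then show "cut K (fst (S n)) \<noteq> {}" "cut K' (snd (S n)) \<noteq> {}"
      using S(1)[of n] unfolding bad_def by auto
  qed
  have "(fst \<circ> s, snd \<circ> s) \<in> K"
  proof (rule closed_baire_approx[OF K(1)])
    fix n
    obtain p where "p \<in> cut K (fst (S n))" using nonempty(1) by blast
    then show "\<exists>p\<in>K. \<forall>i<n. fst p i = (fst \<circ> s) i \<and> snd p i = (snd \<circ> s) i"
      using nth len by (intro bexI[of _ p]) (auto simp: cut_def)
  qed
  moreover have "(fst \<circ> s', snd \<circ> s') \<in> K'"
  proof (rule closed_baire_approx[OF K'(1)])
    fix n
    obtain p where "p \<in> cut K' (snd (S n))" using nonempty(2) by blast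
    then show "\<exists>p\<in>K'. \<forall>i<n. fst p i = (fst \<circ> s') i \<and> snd p i = (snd \<circ> s') i"
      using nth len by (intro bexI[of _ p]) (auto simp: cut_def)
  qed
  ultimately have "fst \<circ> s \<noteq> fst \<circ> s'"
    using K(2) K'(2) assms(3) by force
  then obtain i where i: "fst (s i) \<noteq> fst (s' i)" by (auto simp: fun_eq_iff)
  \<comment> \<open>Entry \<open>i\<close> is fixed only by prefixes of length \<open>Suc i\<close>,
    so the contradiction is with \<open>bad\<close> at \<open>Suc i\<close>.\<close>
  define C where "C = {y::baire. y i = fst (s i)}"
  have "continuous_on UNIV (\<lambda>y::baire. y i)" by simp
  then have "C \<in> sets borel"
    unfolding C_def by (intro borel_closed closed_Collect_eq continuous_intros)
  moreover have "fst ` cut K (fst (S (Suc i))) \<subseteq> C"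
    using nth[of i "Suc i"] len by (auto simp: cut_def C_def)
  moreover have "C \<inter> fst ` cut K' (snd (S (Suc i))) = {}"
    using nth[of i "Suc i"] len i by (auto simp: cut_def C_def)
  ultimately show False
    using S(1)[of "Suc i"] unfolding bad_def separable_by_borel_def by blast
qed

section \<open>Borel sets with sections of bounded size\<close>

lemma measurable_borel_nat_eq: "M \<rightarrow>\<^sub>M (borel :: nat measure) = M \<rightarrow>\<^sub>M count_space UNIV"
  by (rule measurable_cong_sets) (simp_all add: sets_borel_eq_count_space)

lemma borel_measurable_baire_eval [measurable]:
  "(\<lambda>x::baire. x n) \<in> borel \<rightarrow>\<^sub>M count_space UNIV"
proof -
  have "(\<lambda>x::baire. x n) \<in> borel_measurable borel"
    by (intro borel_measurable_continuous_onI) simp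
  then show ?thesis by (simp add: measurable_borel_nat_eq)
qed

lemma measurable_into_baire:
  assumes "\<And>n. (\<lambda>x. f x n) \<in> M \<rightarrow>\<^sub>M count_space UNIV"
  shows "f \<in> M \<rightarrow>\<^sub>M (borel :: baire measure)"
proof (rule measurable_coordinatewise_then_product)
  show "(\<lambda>x. f x i) \<in> borel_measurable M" for i
    using assms[of i] by (simp add: measurable_borel_nat_eq)
qed

text \<open>The functions are total and their graphs may leave \<open>B\<close>, which makes the
  notion monotone and stable under countable unions.\<close>

definition graph_covered :: "(baire \<times> baire) set \<Rightarrow> bool" where
  "graph_covered B \<longleftrightarrow> (\<exists>g::nat \<Rightarrow> baire \<Rightarrow> baire.
     (\<forall>i. g i \<in> borel_measurable borel) \<and> (\<forall>x y. (x, y) \<in> B \<longrightarrow> (\<exists>i. y = g i x)))"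

lemma graph_covered_UN:
  assumes "\<And>n::'b::countable. graph_covered (B n)"
  shows "graph_covered (\<Union>n. B n)"
proof -
  obtain g :: "'b \<Rightarrow> nat \<Rightarrow> baire \<Rightarrow> baire"
    where g: "\<And>n i. g n i \<in> borel_measurable borel"
      "\<And>n x y. (x, y) \<in> B n \<Longrightarrow> \<exists>i. y = g n i x"
    using assms unfolding graph_covered_def by metis
  show ?thesis
    unfolding graph_covered_def
  proof (intro exI[of _ "\<lambda>j. case from_nat j of (n, i) \<Rightarrow> g n i"] conjI allI impI)
    show "(case from_nat j of (n, i) \<Rightarrow> g n i) \<in> borel_measurable borel" for j
      using g(1) by (simp split: prod.split)
    fix x y assume "(x, y) \<in> (\<Union>n. B n)"
    then obtain n i where "y = g n i x" using g(2) by blast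
    then show "\<exists>j. y = (case from_nat j of (n, i) \<Rightarrow> g n i) x"
      by (intro exI[of _ "to_nat (n, i)"]) simp
  qed
qed

lemma graph_covered_Un: "graph_covered A \<Longrightarrow> graph_covered B \<Longrightarrow> graph_covered (A \<union> B)"
  using graph_covered_UN[of "\<lambda>b::bool. if b then A else B"] by (simp add: UNIV_bool Un_commute)

lemma graph_covered_mono: "graph_covered B \<Longrightarrow> A \<subseteq> B \<Longrightarrow> graph_covered A"
  unfolding graph_covered_def by blast

lemma borel_Pair_eval [measurable]:
  "{p::baire \<times> baire. snd p n = m} \<in> sets borel" "{p::baire \<times> baire. snd p n \<noteq> m} \<in> sets borel"
proof -
  have "(\<lambda>p::baire \<times> baire. snd p n) \<in> borel \<rightarrow>\<^sub>M count_space UNIV"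
    by (rule measurable_compose[OF _ borel_measurable_baire_eval])
      (intro borel_measurable_continuous_onI continuous_intros)
  from measurable_sets[OF this, of "{m}"] measurable_sets[OF this, of "- {m}"]
  show "{p::baire \<times> baire. snd p n = m} \<in> sets borel" "{p::baire \<times> baire. snd p n \<noteq> m} \<in> sets borel"
    by (auto simp: vimage_def)
qed

lemma analytic_fst_image_borel:
  "(B :: (baire \<times> baire) set) \<in> sets borel \<Longrightarrow> analytic (fst ` B)"
  by (rule analytic_fst_image, rule analytic_borel)

text \<open>Since each section has at most one point, the projections of the parts of
  \<open>B\<close> with entry \<open>n\<close> equal to \<open>m\<close> and different from
  \<open>m\<close> are disjoint analytic sets. Borel separators then recover the covering function
  entry by entry.\<close>

lemma graph_covered_single_valued:
  assumes B: "B \<in> sets borel" and single_valued: "\<And>x y y'. (x, y) \<in> B \<Longrightarrow> (x, y') \<in> B \<Longrightarrow> y = y'"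
  shows "graph_covered B"
proof -
  have "\<exists>C\<in>sets borel. fst ` (B \<inter> {p. snd p n = m}) \<subseteq> C \<and> C \<inter> fst ` (B \<inter> {p. snd p n \<noteq> m}) = {}" for n m
  proof (rule lusin_separation)
    show "analytic (fst ` (B \<inter> {p. snd p n = m}))" "analytic (fst ` (B \<inter> {p. snd p n \<noteq> m}))"
      using B by (auto intro!: analytic_fst_image_borel sets.Int)
    show "fst ` (B \<inter> {p. snd p n = m}) \<inter> fst ` (B \<inter> {p. snd p n \<noteq> m}) = {}"
      using single_valued by fastforce
  qed
  then obtain C where C: "\<And>n m. C n m \<in> sets borel"
    "\<And>n m. fst ` (B \<inter> {p. snd p n = m}) \<subseteq> C n m"
    "\<And>n m. C n m \<inter> fst ` (B \<inter> {p. snd p n \<noteq> m}) = {}"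
    by metis
  \<comment> \<open>Off the projection of \<open>B\<close> there may be no such \<open>m\<close>;
    the value of \<open>LEAST\<close> is then arbitrary, yet still measurable in
    \<open>x\<close>.\<close>
  define f where "f x n = (LEAST m. x \<in> C n m)" for x n
  have "f \<in> borel_measurable borel"
    unfolding f_def
    by (intro measurable_into_baire measurable_Least pred_sets2[OF C(1)]) simp
  moreover have "y = f x" if "(x, y) \<in> B" for x y
  proof
    fix n
    have "x \<in> C n (y n)" using C(2)[of n "y n"] that by force
    moreover have "m = y n" if "x \<in> C n m" for m
      using C(3)[of n m] that \<open>(x, y) \<in> B\<close> by force
    ultimately show "y n = f x n" unfolding f_def by (metis LeastI)
  qed
  ultimately show ?thesis
    unfolding graph_covered_def by (intro exI[of _ "\<lambda>_. f"]) blast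
qed

definition sections_le :: "nat \<Rightarrow> ('a \<times> 'b) set \<Rightarrow> bool" where
  "sections_le d B \<longleftrightarrow> (\<forall>x. finite (B `` {x}) \<and> card (B `` {x}) \<le> d)"

text \<open>Having more than \<open>d\<close> points in a section is a projection:
  \<open>Suc d\<close> pairwise distinct points are decoded from a single sequence.\<close>

lemma analytic_big_sections:
  fixes d :: nat
  assumes B: "(B :: (baire \<times> baire) set) \<in> sets borel"
  shows "analytic {x. \<exists>w. \<forall>i\<le>d. (x, w i) \<in> B \<and> (\<forall>j<i. w i \<noteq> w j)}"
proof -
  define dec where "dec w i = (\<lambda>n. w (prod_encode (i, n)))" for w :: baire and i :: nat
  have dec_meas: "(\<lambda>p. (fst p, dec (snd p) i)) \<in> borel \<rightarrow>\<^sub>M borel" for i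
    unfolding dec_def by (intro borel_measurable_continuous_onI continuous_on_baire_reindex)
  have cont: "continuous_on UNIV (\<lambda>p::baire \<times> baire. dec (snd p) i)" for i
    unfolding dec_def by (intro continuous_intros continuous_on_baire_eval)
  have "{p. \<forall>i\<le>d. (fst p, dec (snd p) i) \<in> B \<and> (\<forall>j<i. dec (snd p) i \<noteq> dec (snd p) j)}
    = (\<Inter>i\<in>{..d}. (\<lambda>p. (fst p, dec (snd p) i)) -` B \<inter>
        (\<Inter>j\<in>{..<i}. {p. dec (snd p) i \<noteq> dec (snd p) j}))" (is "?S = _")
    by auto
  also have "\<dots> \<in> sets borel"
  proof -
    have "(\<lambda>p. (fst p, dec (snd p) i)) -` B \<in> sets borel" for i
      using measurable_sets[OF dec_meas B] by simp
    moreover have "{p::baire \<times> baire. dec (snd p) i \<noteq> dec (snd p) j} \<in> sets borel" for i j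
      by (rule borel_open, rule open_Collect_neq[OF cont cont])
    ultimately show ?thesis
      by (intro sets.countable_INT'' sets.Int) auto
  qed
  finally have "analytic (fst ` ?S)" by (intro analytic_fst_image analytic_borel)
  also have "fst ` ?S = {x. \<exists>w. \<forall>i\<le>d. (x, w i) \<in> B \<and> (\<forall>j<i. w i \<noteq> w j)}"
  proof (intro equalityI subsetI)
    fix x assume "x \<in> {x. \<exists>w. \<forall>i\<le>d. (x, w i) \<in> B \<and> (\<forall>j<i. w i \<noteq> w j)}"
    then obtain w where w: "\<forall>i\<le>d. (x, w i) \<in> B \<and> (\<forall>j<i. w i \<noteq> w j)" by blast
    have "dec (\<lambda>n. case prod_decode n of (i, m) \<Rightarrow> w i m) i = w i" for i
      by (simp add: dec_def)
    then have "(x, \<lambda>n. case prod_decode n of (i, m) \<Rightarrow> w i m) \<in> ?S" using w by simp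
    then show "x \<in> fst ` ?S" by (rule image_eqI[rotated]) simp
  next
    fix x assume "x \<in> fst ` ?S"
    then obtain z where "(x, z) \<in> ?S" by force
    then show "x \<in> {x. \<exists>w. \<forall>i\<le>d. (x, w i) \<in> B \<and> (\<forall>j<i. w i \<noteq> w j)}"
      by (auto intro!: exI[of _ "dec z"])
  qed
  finally show ?thesis .
qed

lemma big_section_iff:
  assumes "finite S"
  shows "(\<exists>w. \<forall>i\<le>d. w i \<in> S \<and> (\<forall>j<i. w i \<noteq> w j)) \<longleftrightarrow> d < card S"
proof
  assume "\<exists>w. \<forall>i\<le>d. w i \<in> S \<and> (\<forall>j<i. w i \<noteq> w j)"
  then obtain w where w: "\<forall>i\<le>d. w i \<in> S \<and> (\<forall>j<i. w i \<noteq> w j)" by blast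
  then have "inj_on w {..d}" by (intro linorder_inj_onI) (metis atMost_iff, auto)
  moreover have "w ` {..d} \<subseteq> S" using w by auto
  ultimately have "card {..d} \<le> card S" using card_inj_on_le assms by blast
  then show "d < card S" by simp
next
  assume "d < card S"
  obtain h where h: "bij_betw h {0..<card S} S" using ex_bij_betw_nat_finite[OF assms] by blast
  show "\<exists>w. \<forall>i\<le>d. w i \<in> S \<and> (\<forall>j<i. w i \<noteq> w j)"
  proof (intro exI[of _ h] allI impI conjI)
    fix i assume "i \<le> d"
    then show "h i \<in> S" using h \<open>d < card S\<close> by (auto dest: bij_betwE)
    fix j assume "j < i"
    then show "h i \<noteq> h j"
      using h \<open>d < card S\<close> \<open>i \<le> d\<close> by (auto simp: bij_betw_def dest: inj_onD)
  qed
qed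

text \<open>The set \<open>E n m\<close> of points whose section is split by \<open>U n m\<close> is
  only analytic, so the induction cannot be restricted to it directly. On it neither half has more
  than \<open>Suc d\<close> points. Separating it from the analytic set where some half is larger
  gives a Borel \<open>C n m\<close> on which the induction hypothesis covers both halves. Outside
  all \<open>C n m\<close> no cylinder splits a section, so at most one point remains in it.\<close>

theorem borel_finite_sections_graph_covered:
  assumes "B \<in> sets borel" "sections_le (Suc d) B"
  shows "graph_covered B"
  using assms
proof (induction d arbitrary: B)
  case 0
  show ?case
  proof (rule graph_covered_single_valued[OF 0(1)])
    fix x y y' assume "(x, y) \<in> B" "(x, y') \<in> B"
    then show "y = y'"
      using 0(2) unfolding sections_le_def
      by (metis One_nat_def Image_singleton_iff card_le_Suc0_iff_eq)
  qed
next
  case (Suc d)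
  define U where "U n m = {p::baire \<times> baire. snd p n = m}" for n m
  define big where "big A = {x. \<exists>w. \<forall>i\<le>Suc d. (x, w i) \<in> A \<and> (\<forall>j<i. w i \<noteq> w j)}"
    for A :: "(baire \<times> baire) set"
  define E where "E n m = fst ` (B \<inter> U n m) \<inter> fst ` (B - U n m)" for n m
  have fin: "finite (B `` {x})" "card (B `` {x}) \<le> Suc (Suc d)" for x
    using Suc.prems(2) unfolding sections_le_def by auto
  have big_iff: "x \<in> big A \<longleftrightarrow> Suc d < card (A `` {x})" if "A \<subseteq> B" for A x
  proof -
    have "finite (A `` {x})" using fin(1)[of x] that by (meson Image_mono finite_subset order_refl)
    then show ?thesis using big_section_iff[of "A `` {x}" "Suc d"] unfolding big_def by simp
  qed
  have U [measurable]: "U n m \<in> sets borel" for n m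
    unfolding U_def by (rule borel_Pair_eval)
  have BU: "B \<inter> U n m \<in> sets borel" "B - U n m \<in> sets borel" for n m
    using Suc.prems(1) U by auto
  have "\<exists>C\<in>sets borel. E n m \<subseteq> C \<and> C \<inter> (big (B \<inter> U n m) \<union> big (B - U n m)) = {}" for n m
  proof (rule lusin_separation)
    show "analytic (E n m)"
      unfolding E_def using BU by (intro analytic_Int[OF analytic_fst_image_borel analytic_fst_image_borel])
    show "analytic (big (B \<inter> U n m) \<union> big (B - U n m))"
      unfolding big_def using BU by (intro analytic_Un analytic_big_sections)
    have False if "x \<in> E n m" "x \<in> big (B \<inter> U n m) \<or> x \<in> big (B - U n m)" for x
    proof -
      have "card (B `` {x}) = card ((B \<inter> U n m) `` {x}) + card ((B - U n m) `` {x})"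
        by (subst card_Un_disjoint[symmetric])
          (auto simp: U_def intro!: finite_subset[OF _ fin(1)] arg_cong[where f = card])
      moreover have "(B \<inter> U n m) `` {x} \<noteq> {}" "(B - U n m) `` {x} \<noteq> {}"
        using that(1) by (auto simp: E_def)
      then have "card ((B \<inter> U n m) `` {x}) \<noteq> 0" "card ((B - U n m) `` {x}) \<noteq> 0"
        using finite_subset[OF _ fin(1)[of x], of "(B \<inter> U n m) `` {x}"]
          finite_subset[OF _ fin(1)[of x], of "(B - U n m) `` {x}"]
        by (simp_all add: card_eq_0_iff Image_mono)
      moreover have "Suc d < card ((B \<inter> U n m) `` {x}) \<or> Suc d < card ((B - U n m) `` {x})"
        using that(2) by (simp add: big_iff)
      ultimately show False using fin(2)[of x] by linarith
    qed
    then show "E n m \<inter> (big (B \<inter> U n m) \<union> big (B - U n m)) = {}" by blast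
  qed
  then obtain C where C: "\<And>n m. C n m \<in> sets borel" "\<And>n m. E n m \<subseteq> C n m"
    "\<And>n m. C n m \<inter> (big (B \<inter> U n m) \<union> big (B - U n m)) = {}"
    by metis
  have C2: "C n m \<times> UNIV \<in> sets borel" for n m
  proof -
    have "fst \<in> borel \<rightarrow>\<^sub>M (borel :: baire measure)"
      by (intro borel_measurable_continuous_onI continuous_intros)
    from measurable_sets[OF this C(1)[of n m]] show ?thesis by (simp add: vimage_fst)
  qed
  have small: "graph_covered (A \<inter> C n m \<times> UNIV)"
    if "A \<subseteq> B" "A \<in> sets borel" "C n m \<inter> big A = {}" for A n m
  proof (rule Suc.IH)
    show "A \<inter> C n m \<times> UNIV \<in> sets borel" using that(2) C2 by (rule sets.Int)
    have "finite ((A \<inter> C n m \<times> UNIV) `` {x}) \<and> card ((A \<inter> C n m \<times> UNIV) `` {x}) \<le> Suc d" for x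
    proof (cases "x \<in> C n m")
      case True
      then have "(A \<inter> C n m \<times> UNIV) `` {x} = A `` {x}" by auto
      moreover have "\<not> Suc d < card (A `` {x})" using that(1,3) True big_iff by blast
      moreover have "finite (A `` {x})" using that(1) fin(1)[of x] by (meson Image_mono finite_subset order_refl)
      ultimately show ?thesis by simp
    next
      case False
      then have "(A \<inter> C n m \<times> UNIV) `` {x} = {}" by auto
      then show ?thesis by simp
    qed
    then show "sections_le (Suc d) (A \<inter> C n m \<times> UNIV)" unfolding sections_le_def by blast
  qed
  have "graph_covered (B \<inter> C n m \<times> UNIV)" for n m
  proof -
    have "graph_covered ((B \<inter> U n m) \<inter> C n m \<times> UNIV \<union> (B - U n m) \<inter> C n m \<times> UNIV)"
      using C(3)[of n m] BU by (intro graph_covered_Un small) auto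
    then show ?thesis by (rule graph_covered_mono) blast
  qed
  then have "graph_covered (\<Union>nm. B \<inter> C (fst nm) (snd nm) \<times> UNIV)" by (intro graph_covered_UN)
  moreover have "graph_covered (B - (\<Union>nm. C (fst nm) (snd nm) \<times> UNIV))"
  proof (rule graph_covered_single_valued)
    show "B - (\<Union>nm. C (fst nm) (snd nm) \<times> UNIV) \<in> sets borel"
      using Suc.prems(1) C2 by (intro sets.Diff sets.countable_UN'') auto
    fix x y y' assume *: "(x, y) \<in> B - (\<Union>nm. C (fst nm) (snd nm) \<times> UNIV)"
      "(x, y') \<in> B - (\<Union>nm. C (fst nm) (snd nm) \<times> UNIV)"
    show "y = y'"
    proof (rule ccontr)
      assume "y \<noteq> y'"
      then obtain n where "y n \<noteq> y' n" by blast
      then have "(x, y) \<in> B \<inter> U n (y n)" "(x, y') \<in> B - U n (y n)" using * by (auto simp: U_def)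
      then have "x \<in> C n (y n)" using C(2)[of n "y n"] by (force simp: E_def)
      then show False using * by auto
    qed
  qed
  ultimately show ?case
    by (rule graph_covered_mono[OF graph_covered_Un]) blast
qed

section \<open>Standard Borel spaces as retracts of the Baire space\<close>

lemma borel_baire_Collect_eval2 [measurable]:
  "Measurable.pred borel (\<lambda>u::baire. Q (u n) (u m))"
proof (rule measurable_compose_countable[where f = "\<lambda>i u. Q i (u m)" and g = "\<lambda>u. u n",
      OF _ borel_measurable_baire_eval])
  show "Measurable.pred borel (\<lambda>u::baire. Q i (u m))" for i
    by (rule measurable_compose[OF borel_measurable_baire_eval]) simp
qed

text \<open>A point is coded by the least indices of dense points within \<open>r n\<close> of it,
  and \<open>h\<close> decodes a sequence by taking the limit of those dense points. As
  \<open>h\<close> is total and Borel, Borel sets can be pulled back to the Baire space.\<close>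

lemma standard_borel_baire_retract:
  assumes "standard_borel_space X" "space X \<noteq> {}"
  obtains c h where "c \<in> X \<rightarrow>\<^sub>M (borel :: baire measure)" "h \<in> (borel :: baire measure) \<rightarrow>\<^sub>M X"
    "\<And>x. x \<in> space X \<Longrightarrow> h (c x) = x"
proof -
  obtain T where T: "completely_metrizable_space T" "separable_space T" "topspace T = space X"
    "sets X = sigma_sets (space X) {U. openin T U}"
    using assms unfolding standard_borel_space_def by blast
  obtain M d where Md: "Metric_space M d" "Metric_space.mcomplete M d" "T = Metric_space.mtopology M d"
    using T(1) unfolding completely_metrizable_space_def by blast
  interpret Metric_space M d by (rule Md(1))
  have M: "M = space X" using T(3) Md(3) by simp
  obtain D where D: "countable D" "D \<subseteq> M" "mtopology closure_of D = M"
    using T(2) Md(3) unfolding separable_space_def by auto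
  obtain x0 where x0: "x0 \<in> M" using assms(2) M by blast
  have "D \<noteq> {}" using D(3) x0 by auto
  define y where "y = from_nat_into D"
  have y: "y j \<in> M" for j using D(2) from_nat_into[OF \<open>D \<noteq> {}\<close>] unfolding y_def by blast
  define r :: "nat \<Rightarrow> real" where "r n = (1/2) ^ n" for n
  have r_pos: "0 < r n" for n unfolding r_def by simp
  have r_small: "\<exists>n. r n < e" if "e > 0" for e
    unfolding r_def using real_arch_pow_inv[OF that, of "1/2"] by auto
  have r_mono: "r m \<le> r n" if "n \<le> m" for n m
    unfolding r_def using that by (intro power_decreasing) auto
  have dense: "\<exists>j. d x (y j) < e" if "x \<in> M" "e > 0" for x e
  proof -
    have "x \<in> mtopology closure_of D" using that D(3) by simp
    then obtain z where "z \<in> D" "z \<in> mball x e"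
      using \<open>e > 0\<close> by (auto simp: metric_closure_of)
    then show ?thesis
      using from_nat_into_surj[OF D(1)] unfolding y_def by (metis in_mball)
  qed
  define c where "c x n = (LEAST j. d x (y j) < r n)" for x n
  have c_less: "d x (y (c x n)) < r n" if "x \<in> M" for x n
    unfolding c_def using dense[OF that r_pos] by (rule LeastI_ex)
  \<comment> \<open>Codes satisfy this by the triangle inequality through the coded point.
    Conversely it is a Borel condition that forces the dense points to be Cauchy.\<close>
  define W where "W = {u::baire. \<forall>n m. d (y (u n)) (y (u m)) \<le> r n + r m}"
  define lims where "lims u x \<longleftrightarrow> x \<in> M \<and> (\<forall>n. d x (y (u n)) \<le> r n)" for u :: baire and x
  have lims_unique: "x = x'" if "lims u x" "lims u x'" for u x x'
  proof (rule ccontr)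
    assume "x \<noteq> x'"
    then have "d x x' > 0" using that unfolding lims_def by simp
    then obtain n where n: "r n < d x x' / 2" using r_small[of "d x x' / 2"] by auto
    have "d x x' \<le> d x (y (u n)) + d (y (u n)) x'"
      using that y unfolding lims_def by (intro triangle) auto
    also have "\<dots> \<le> r n + r n"
      using that unfolding lims_def by (intro add_mono) (auto simp: commute)
    finally show False using n by simp
  qed
  have lims_ex: "\<exists>x. lims u x" if "u \<in> W" for u
  proof -
    have "MCauchy (\<lambda>n. y (u n))"
      unfolding MCauchy_def
    proof (intro conjI allI impI)
      show "range (\<lambda>n. y (u n)) \<subseteq> M" using y by blast
      fix e :: real assume "e > 0"
      then obtain N where N: "r N < e / 2" using r_small[of "e / 2"] by auto
      have "d (y (u n)) (y (u n')) < e" if "N \<le> n" "N \<le> n'" for n n'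
      proof -
        have "d (y (u n)) (y (u n')) \<le> r n + r n'" using \<open>u \<in> W\<close> unfolding W_def by blast
        then show ?thesis using r_mono[OF that(1)] r_mono[OF that(2)] N by linarith
      qed
      then show "\<exists>N. \<forall>n n'. N \<le> n \<longrightarrow> N \<le> n' \<longrightarrow> d (y (u n)) (y (u n')) < e" by blast
    qed
    then obtain x where x: "limitin mtopology (\<lambda>n. y (u n)) x sequentially"
      using Md(2) unfolding mcomplete_def by blast
    then have "x \<in> M" by (simp add: limit_metric_sequentially)
    have "d x (y (u n)) \<le> r n" for n
    proof (rule field_le_epsilon)
      fix e :: real assume "e > 0"
      then obtain N where N: "\<And>m. m \<ge> N \<Longrightarrow> d (y (u m)) x < e / 2"
        using x unfolding limit_metric_sequentially by (metis half_gt_zero)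
      obtain k where k: "r k < e / 2" using r_small[of "e / 2"] \<open>e > 0\<close> by auto
      define m where "m = max N k"
      have "d x (y (u n)) \<le> d x (y (u m)) + d (y (u m)) (y (u n))"
        using \<open>x \<in> M\<close> y by (intro triangle) auto
      moreover have "d x (y (u m)) < e / 2" using N[of m] by (simp add: m_def commute)
      moreover have "d (y (u m)) (y (u n)) \<le> r m + r n" using \<open>u \<in> W\<close> unfolding W_def by blast
      moreover have "r m \<le> r k" by (rule r_mono) (simp add: m_def)
      ultimately show "d x (y (u n)) \<le> r n + e" using k by linarith
    qed
    then show ?thesis using \<open>x \<in> M\<close> unfolding lims_def by blast
  qed
  define h where "h u = (if u \<in> W then SOME x. lims u x else x0)" for u
  have lims_h: "lims u (h u)" if "u \<in> W" for u
    unfolding h_def using that lims_ex[OF that] by (auto intro: someI_ex)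
  have h_M: "h u \<in> M" for u
    using lims_h[of u] x0 by (cases "u \<in> W") (auto simp: lims_def h_def)
  show thesis
  proof
    show "h (c x) = x" if "x \<in> space X" for x
    proof -
      have x: "x \<in> M" using that M by simp
      have "d (y (c x n)) (y (c x m)) \<le> r n + r m" for n m
      proof -
        have "d (y (c x n)) (y (c x m)) \<le> d (y (c x n)) x + d x (y (c x m))"
          using x y by (intro triangle) auto
        then show ?thesis using c_less[OF x, of n] c_less[OF x, of m] by (simp add: commute)
      qed
      then have "c x \<in> W" unfolding W_def by blast
      moreover have "lims (c x) x" unfolding lims_def using x c_less[OF x] less_imp_le by blast
      ultimately show ?thesis using lims_unique lims_h by blast
    qed
    show "c \<in> X \<rightarrow>\<^sub>M borel"
    proof (rule measurable_into_baire)
      have "Measurable.pred X (\<lambda>x. d x (y j) < r n)" for n j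
      proof -
        have "{x \<in> space X. d x (y j) < r n} = mball (y j) (r n)"
          using y by (auto simp: M[symmetric] commute)
        also have "\<dots> \<in> sets X" unfolding T(4) using Md(3) by (intro sigma_sets.Basic) simp
        finally show ?thesis by (simp add: pred_def)
      qed
      then show "(\<lambda>x. c x n) \<in> X \<rightarrow>\<^sub>M count_space UNIV" for n
        unfolding c_def by (intro measurable_Least)
    qed
    have "Measurable.pred borel (\<lambda>u::baire. \<forall>n m. d (y (u n)) (y (u m)) \<le> r n + r m)"
      by measurable
    then have W: "W \<in> sets borel" by (simp add: W_def pred_def)
    show "h \<in> borel \<rightarrow>\<^sub>M X"
    proof (rule measurable_sigma_sets[OF T(4)])
      show "{U. openin T U} \<subseteq> Pow (space X)" using T(3) openin_subset by blast
      show "h \<in> space borel \<rightarrow> space X" using h_M M by auto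
      fix U assume "U \<in> {U. openin T U}"
      then have U: "openin mtopology U" using Md(3) by simp
      \<comment> \<open>These are the cylinders that \<open>h\<close> maps into \<open>U\<close>
        within \<open>W\<close>. There are countably many, and they exhaust the preimage of
        \<open>U\<close> in \<open>W\<close> because \<open>h u\<close> stays within
        \<open>r n\<close> of \<open>y (u n)\<close>. Off \<open>W\<close> the value is the constant
        \<open>x0\<close>.\<close>
      define J where "J = {(n, a). \<forall>u\<in>W. u n = a \<longrightarrow> h u \<in> U}"
      have near: "\<exists>n. (n, u n) \<in> J" if "u \<in> W" "h u \<in> U" for u
      proof -
        obtain e where e: "e > 0" "mball (h u) e \<subseteq> U"
          using U \<open>h u \<in> U\<close> unfolding openin_mtopology by blast
        obtain n where n: "r n < e / 2" using r_small[of "e / 2"] e by auto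
        have "h v \<in> U" if "v \<in> W" "v n = u n" for v
        proof -
          have "d (h u) (h v) \<le> d (h u) (y (u n)) + d (y (u n)) (h v)"
            using h_M y by (intro triangle) auto
          moreover have "d (h u) (y (u n)) \<le> r n" "d (y (u n)) (h v) \<le> r n"
            using lims_h[OF \<open>u \<in> W\<close>] lims_h[OF \<open>v \<in> W\<close>] that(2)
            by (auto simp: lims_def commute dest: spec[of _ n])
          ultimately have "d (h u) (h v) < e" using n by linarith
          then show ?thesis using e(2) h_M by auto
        qed
        then show ?thesis unfolding J_def by blast
      qed
      have "h -` U \<inter> space borel =
        (W \<inter> (\<Union>(n, a)\<in>J. {u. u n = a})) \<union> (if x0 \<in> U then - W else {})"
      proof (intro equalityI subsetI)
        fix u assume "u \<in> h -` U \<inter> space borel"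
        then show "u \<in> (W \<inter> (\<Union>(n, a)\<in>J. {u. u n = a})) \<union> (if x0 \<in> U then - W else {})"
          using near[of u] by (cases "u \<in> W") (force, simp add: h_def)
      next
        fix u assume "u \<in> (W \<inter> (\<Union>(n, a)\<in>J. {u. u n = a})) \<union> (if x0 \<in> U then - W else {})"
        then show "u \<in> h -` U \<inter> space borel"
          by (cases "u \<in> W") (auto simp: J_def h_def split: if_splits)
      qed
      also have "\<dots> \<in> sets borel"
      proof -
        have "{u::baire. u n = a} \<in> sets borel" for n a
          using measurable_sets[OF borel_measurable_baire_eval, of "{a}" n]
          by (simp add: vimage_def)
        moreover have "countable J" by (rule countableI_type)
        ultimately have "(\<Union>(n, a)\<in>J. {u::baire. u n = a}) \<in> sets borel"
          by (intro sets.countable_UN') auto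
        then show ?thesis using W by (auto intro!: sets.Un sets.Int)
      qed
      finally show "h -` U \<inter> space borel \<in> sets borel" .
    qed
  qed
qed

text \<open>The covering theorem is applied to the relation \<open>B'\<close> between codes. Its
  second entry must be the canonical code \<open>c (h v)\<close>; otherwise the many codes of one
  point could make the sections infinite. The bound is raised to \<open>Suc d\<close> to fit the
  form of the covering theorem, which includes \<open>d = 0\<close>.\<close>

theorem finite_sections_enumeration:
  assumes X: "standard_borel_space X" and B: "B \<in> sets (X \<Otimes>\<^sub>M X)"
    and sections: "\<And>x. x \<in> space X \<Longrightarrow> finite (B `` {x}) \<and> card (B `` {x}) \<le> d"
  shows "\<exists>f::nat \<Rightarrow> 'a \<Rightarrow> 'a. (\<forall>i. f i \<in> X \<rightarrow>\<^sub>M X) \<and> (\<forall>x y. (x, y) \<in> B \<longrightarrow> (\<exists>i. y = f i x))"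
proof (cases "space X = {}")
  case True
  then have "B = {}" using sets.sets_into_space[OF B] by (auto simp: space_pair_measure)
  then show ?thesis by (intro exI[of _ "\<lambda>_ x. x"]) auto
next
  case False
  obtain c h where c: "c \<in> X \<rightarrow>\<^sub>M (borel :: baire measure)" and h: "h \<in> (borel :: baire measure) \<rightarrow>\<^sub>M X"
    and hc: "\<And>x. x \<in> space X \<Longrightarrow> h (c x) = x"
    using standard_borel_baire_retract[OF X False] by blast
  note [measurable] = c h B
  have ch: "(\<lambda>v. c (h v) n) \<in> borel \<rightarrow>\<^sub>M count_space UNIV" for n
    by (rule measurable_compose[OF measurable_compose[OF h c] borel_measurable_baire_eval])
  define B' where "B' = {p. (h (fst p), h (snd p)) \<in> B \<and> c (h (snd p)) = snd p}"
  have B'_iff: "(u, v) \<in> B' \<longleftrightarrow> (h u, h v) \<in> B \<and> c (h v) = v" for u v by (simp add: B'_def)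
  have "Measurable.pred (borel \<Otimes>\<^sub>M borel) (\<lambda>p. (h (fst p), h (snd p)) \<in> B)"
    by measurable
  moreover have "Measurable.pred (borel \<Otimes>\<^sub>M borel) (\<lambda>p::baire \<times> baire. c (h (snd p)) = snd p)"
  proof -
    have "Measurable.pred borel (\<lambda>v::baire. \<forall>n. c (h v) n = v n)"
      using ch by measurable
    then have "Measurable.pred borel (\<lambda>v::baire. c (h v) = v)" by (simp add: fun_eq_iff)
    from measurable_compose[OF measurable_snd this] show ?thesis .
  qed
  ultimately have "Measurable.pred (borel \<Otimes>\<^sub>M borel) (\<lambda>p. p \<in> B')"
    unfolding B'_def mem_Collect_eq by measurable
  then have "B' \<in> sets borel"
    unfolding borel_prod by (simp add: pred_def)
  moreover have "sections_le (Suc d) B'"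
    unfolding sections_le_def
  proof
    fix u
    have "h u \<in> space X" using measurable_space[OF h, of u] by simp
    then have fin: "finite (B `` {h u})" "card (B `` {h u}) \<le> d" using sections by auto
    have sub: "B' `` {u} \<subseteq> c ` (B `` {h u})" by (force simp: B'_iff)
    have "card (B' `` {u}) \<le> card (c ` (B `` {h u}))" using sub fin by (intro card_mono) auto
    also have "\<dots> \<le> card (B `` {h u})" by (rule card_image_le[OF fin(1)])
    finally show "finite (B' `` {u}) \<and> card (B' `` {u}) \<le> Suc d"
      using fin finite_subset[OF sub] by auto
  qed
  ultimately obtain g where g: "\<And>i. g i \<in> borel_measurable (borel :: baire measure)"
    "\<And>u v. (u, v) \<in> B' \<Longrightarrow> \<exists>i::nat. v = g i u"
    using borel_finite_sections_graph_covered unfolding graph_covered_def by metis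
  show ?thesis
  proof (intro exI[of _ "\<lambda>i x. h (g i (c x))"] conjI allI impI)
    show "(\<lambda>x. h (g i (c x))) \<in> X \<rightarrow>\<^sub>M X" for i
      by (rule measurable_compose[OF measurable_compose[OF c g(1)] h])
    fix x y assume "(x, y) \<in> B"
    then have xy: "x \<in> space X" "y \<in> space X"
      using sets.sets_into_space[OF B] by (auto simp: space_pair_measure)
    then have "(c x, c y) \<in> B'" using \<open>(x, y) \<in> B\<close> hc by (simp add: B'_iff)
    then obtain i where "c y = g i (c x)" using g(2) by blast
    then show "\<exists>i. y = h (g i (c x))" using hc xy(2) by metis
  qed
qed

text \<open>Colouring \<open>N\<close> is the prefix of length \<open>N\<close> of the code.
  Countably many colours cannot separate all points of an uncountable space, but some prefix
  separates any given finite set.\<close>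

lemma standard_borel_colourings:
  assumes "standard_borel_space X"
  shows "\<exists>\<kappa>::nat \<Rightarrow> 'a \<Rightarrow> nat. (\<forall>N. \<kappa> N \<in> X \<rightarrow>\<^sub>M count_space UNIV) \<and>
    (\<forall>F. finite F \<and> F \<subseteq> space X \<longrightarrow> (\<exists>N. inj_on (\<kappa> N) F))"
proof (cases "space X = {}")
  case True
  then show ?thesis by (intro exI[of _ "\<lambda>_ _. 0"]) auto
next
  case False
  obtain c h where c: "c \<in> X \<rightarrow>\<^sub>M (borel :: baire measure)" and h: "h \<in> (borel :: baire measure) \<rightarrow>\<^sub>M X"
    and hc: "\<And>x. x \<in> space X \<Longrightarrow> h (c x) = x"
    using standard_borel_baire_retract[OF assms False] by blast
  have prefix: "(\<lambda>u::baire. map u [0..<N]) \<in> borel \<rightarrow>\<^sub>M count_space UNIV" for N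
  proof (induction N)
    case (Suc N)
    have "(\<lambda>u::baire. l @ [u N]) \<in> borel \<rightarrow>\<^sub>M count_space UNIV" for l
      by (rule measurable_compose[OF borel_measurable_baire_eval]) simp
    from measurable_compose_countable[where f = "\<lambda>l u. l @ [u N]", OF this Suc]
    show ?case by simp
  qed simp
  show ?thesis
  proof (intro exI[of _ "\<lambda>N x. list_encode (map (c x) [0..<N])"] conjI allI impI)
    show "(\<lambda>x. list_encode (map (c x) [0..<N])) \<in> X \<rightarrow>\<^sub>M count_space UNIV" for N
      by (rule measurable_compose[OF measurable_compose[OF c prefix]]) simp
    fix F assume F: "finite F \<and> F \<subseteq> space X"
    have "\<exists>n. x \<noteq> y \<longrightarrow> c x n \<noteq> c y n" if "x \<in> F" "y \<in> F" for x y
      using hc F that by (metis ext subsetD)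
    then obtain n where n: "\<And>x y. x \<in> F \<Longrightarrow> y \<in> F \<Longrightarrow> x \<noteq> y \<Longrightarrow> c x (n x y) \<noteq> c y (n x y)"
      by metis
    define N where "N = Suc (Max ((\<lambda>(x, y). n x y) ` (F \<times> F)))"
    have "n x y < N" if "x \<in> F" "y \<in> F" for x y
      unfolding N_def less_Suc_eq_le using F that by (intro Max_ge) auto
    then have "inj_on (\<lambda>x. list_encode (map (c x) [0..<N])) F"
      using n by (intro inj_onI) (fastforce simp: list_encode_eq)
    then show "\<exists>N. inj_on (\<lambda>x. list_encode (map (c x) [0..<N])) F" ..
  qed
qed

section \<open>Bounded degree Borel graphs as unions of partial injections\<close>

lemma suminf_indicator_eq_ecount:
  assumes "bij_betw h {n::nat. P n} S"
  shows "(\<Sum>n. if P n then 1 else 0 :: ennreal) = ecount S"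
proof -
  have "(\<Sum>n. if P n then 1 else 0 :: ennreal) = (\<integral>\<^sup>+n. indicator {n. P n} n \<partial>count_space UNIV)"
    by (simp add: nn_integral_count_space_nat[symmetric] indicator_def of_bool_def)
  also have "\<dots> = ecount {n. P n}" by (simp add: ecount_def)
  also have "\<dots> = ecount S"
    using bij_betw_same_card[OF assms] bij_betw_finite[OF assms]
    by (simp add: ecount_def emeasure_count_space)
  finally show ?thesis .
qed

lemma ecount_finite: "finite S \<Longrightarrow> ecount S = of_nat (card S)"
  by (simp add: ecount_def emeasure_count_space_finite)

text \<open>Every arc is carried by exactly one index, which turns degrees into sums of indicators,
  and \<open>\<psi> n\<close> inverts \<open>\<phi> n\<close> on \<open>Dom n\<close>, which makes
  images Borel. The colourings separate points and, later, the vertices of finite paths.\<close>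

locale enumerated_graph =
  fixes X :: "'a measure" and G :: "('a \<times> 'a) set"
    and \<phi> \<psi> :: "nat \<Rightarrow> 'a \<Rightarrow> 'a" and Dom :: "nat \<Rightarrow> 'a set"
    and \<kappa> :: "nat \<Rightarrow> 'a \<Rightarrow> nat" and deg :: nat
  assumes G_sets [measurable]: "G \<in> sets (X \<Otimes>\<^sub>M X)"
    and G_sym: "sym G" and G_irrefl: "irrefl G"
    and G_degree: "\<And>x. finite (G `` {x}) \<and> card (G `` {x}) \<le> deg"
    and \<phi>_measurable [measurable]: "\<And>n. \<phi> n \<in> X \<rightarrow>\<^sub>M X"
    and \<psi>_measurable [measurable]: "\<And>n. \<psi> n \<in> X \<rightarrow>\<^sub>M X"
    and Dom_sets [measurable]: "\<And>n. Dom n \<in> sets X"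
    and \<psi>_\<phi>: "\<And>n x. x \<in> Dom n \<Longrightarrow> \<psi> n (\<phi> n x) = x"
    and Dom_edge: "\<And>n x. x \<in> Dom n \<Longrightarrow> (x, \<phi> n x) \<in> G"
    and edge_unique: "\<And>x y. (x, y) \<in> G \<Longrightarrow> \<exists>!n. x \<in> Dom n \<and> \<phi> n x = y"
    and \<kappa>_measurable [measurable]: "\<And>N. \<kappa> N \<in> X \<rightarrow>\<^sub>M count_space UNIV"
    and \<kappa>_inj: "\<And>F. finite F \<Longrightarrow> F \<subseteq> space X \<Longrightarrow> \<exists>N. inj_on (\<kappa> N) F"

text \<open>The colourings separate any two points, so equality is a countable conjunction of
  equalities of colours.\<close>

lemma measurable_pred_eq:
  fixes \<kappa> :: "nat \<Rightarrow> 'a \<Rightarrow> nat"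
  assumes \<kappa>: "\<And>N. \<kappa> N \<in> X \<rightarrow>\<^sub>M count_space UNIV" and f: "f \<in> M \<rightarrow>\<^sub>M X" and g: "g \<in> M \<rightarrow>\<^sub>M X"
    and inj: "\<And>F. finite F \<Longrightarrow> F \<subseteq> space X \<Longrightarrow> \<exists>N. inj_on (\<kappa> N) F"
  shows "Measurable.pred M (\<lambda>x. f x = g x)"
proof -
  have "{x \<in> space M. \<kappa> N (f x) = \<kappa> N (g x)} \<in> sets M" for N
    by (rule borel_measurable_eq; subst measurable_borel_nat_eq)
      (rule measurable_compose[OF f \<kappa>], rule measurable_compose[OF g \<kappa>])
  then have "{x \<in> space M. \<forall>N. \<kappa> N (f x) = \<kappa> N (g x)} \<in> sets M"
    by (rule sets.sets_Collect_countable_All)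
  also have "{x \<in> space M. \<forall>N. \<kappa> N (f x) = \<kappa> N (g x)} = {x \<in> space M. f x = g x}"
  proof (rule Collect_cong, rule conj_cong[OF refl])
    fix x assume x: "x \<in> space M"
    have "{f x, g x} \<subseteq> space X"
      using measurable_space[OF f x] measurable_space[OF g x] by simp
    from inj[OF _ this] obtain N where N: "inj_on (\<kappa> N) {f x, g x}" by auto
    show "(\<forall>N. \<kappa> N (f x) = \<kappa> N (g x)) \<longleftrightarrow> f x = g x"
    proof
      assume "\<forall>N. \<kappa> N (f x) = \<kappa> N (g x)"
      then show "f x = g x" by (intro inj_onD[OF N]) (rule spec, simp_all)
    qed simp
  qed
  finally show ?thesis by (simp add: pred_def)
qed

text \<open>The functions \<open>f i\<close> covering \<open>G\<close> need not be injective. An arc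
  from \<open>x\<close> to \<open>y\<close> is therefore labelled by two indices: the first one
  taking \<open>x\<close> to \<open>y\<close> and the first one taking \<open>y\<close> to
  \<open>x\<close>. With the label fixed, either endpoint determines the other, so each label class
  is a partial injection.\<close>

lemma ex_enumerated_graph:
  assumes X: "standard_borel_space X" and G: "borel_graph X G" and "bounded_degree X G"
  shows "\<exists>\<phi> \<psi> Dom \<kappa> deg. enumerated_graph X G \<phi> \<psi> Dom \<kappa> deg"
proof -
  have G_sets [measurable]: "G \<in> sets (X \<Otimes>\<^sub>M X)" and sym: "sym G" and irr: "irrefl G"
    using G unfolding borel_graph_def by auto
  have G_space: "x \<in> space X \<and> y \<in> space X" if "(x, y) \<in> G" for x y
    using that sets.sets_into_space[OF G_sets] by (auto simp: space_pair_measure)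
  obtain d where d: "\<And>x. x \<in> space X \<Longrightarrow> finite (G `` {x}) \<and> card (G `` {x}) \<le> d"
    using assms(3) unfolding bounded_degree_def by blast
  have d': "finite (G `` {x}) \<and> card (G `` {x}) \<le> d" for x
  proof (cases "x \<in> space X")
    case False
    then have "G `` {x} = {}" using G_space by blast
    then show ?thesis by simp
  qed (rule d)
  from finite_sections_enumeration[OF X G_sets d]
  obtain f :: "nat \<Rightarrow> 'a \<Rightarrow> 'a" where f_all: "\<forall>i. f i \<in> X \<rightarrow>\<^sub>M X"
    and f_ex: "\<forall>x y. (x, y) \<in> G \<longrightarrow> (\<exists>i. y = f i x)"
    by blast
  have f [measurable]: "f i \<in> X \<rightarrow>\<^sub>M X" for i using f_all by blast
  from standard_borel_colourings[OF X]
  obtain \<kappa> :: "nat \<Rightarrow> 'a \<Rightarrow> nat" where \<kappa>_all: "\<forall>N. \<kappa> N \<in> X \<rightarrow>\<^sub>M count_space UNIV"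
    "\<forall>F. finite F \<and> F \<subseteq> space X \<longrightarrow> (\<exists>N. inj_on (\<kappa> N) F)"
    by blast
  have \<kappa>: "\<kappa> N \<in> X \<rightarrow>\<^sub>M count_space UNIV"
    "finite F \<Longrightarrow> F \<subseteq> space X \<Longrightarrow> \<exists>N. inj_on (\<kappa> N) F" for N F
    using \<kappa>_all by blast+
  define first where "first x y i \<longleftrightarrow> y = f i x \<and> (\<forall>j<i. f j x \<noteq> y)" for x y i
  have first_ex: "\<exists>i. first x y i" if "(x, y) \<in> G" for x y
  proof -
    have ex: "\<exists>i. y = f i x" using f_ex that by blast
    define i where "i = (LEAST i. y = f i x)"
    have "y = f i x" unfolding i_def by (rule LeastI_ex[OF ex])
    moreover have "f j x \<noteq> y" if "j < i" for j
      using not_less_Least[of j "\<lambda>i. y = f i x"] that unfolding i_def by blast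
    ultimately show ?thesis
      unfolding first_def by (intro exI[of _ i] conjI allI impI)
  qed
  have first_unique: "i = j" if i: "first x y i" and j: "first x y j" for x y i j
  proof (rule linorder_cases[of i j])
    assume "i < j"
    then have "f i x \<noteq> y" using j unfolding first_def by (elim conjE allE impE)
    then show ?thesis using i unfolding first_def by simp
  next
    assume "j < i"
    then have "f j x \<noteq> y" using i unfolding first_def by (elim conjE allE impE)
    then show ?thesis using j unfolding first_def by simp
  qed
  define D where "D i j = {x \<in> space X. (x, f i x) \<in> G \<and> first x (f i x) i \<and> first (f i x) x j}" for i j
  have D_sets: "D i j \<in> sets X" for i j
  proof -
    have eq: "Measurable.pred X (\<lambda>x. g x = h x)" if "g \<in> X \<rightarrow>\<^sub>M X" "h \<in> X \<rightarrow>\<^sub>M X" for g h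
      using that by (rule measurable_pred_eq[OF \<kappa>(1) _ _ \<kappa>(2)])
    have ff: "(\<lambda>x. f l (f i x)) \<in> X \<rightarrow>\<^sub>M X" for l by (rule measurable_compose[OF f f])
    have id: "(\<lambda>x. x) \<in> X \<rightarrow>\<^sub>M X" by (rule measurable_ident_sets[OF refl])
    have "(\<lambda>x. (x, f i x)) \<in> X \<rightarrow>\<^sub>M X \<Otimes>\<^sub>M X" by (rule measurable_Pair[OF id f])
    from measurable_sets[OF this G_sets]
    have 1: "{x \<in> space X. (x, f i x) \<in> G} \<in> sets X" by (simp add: vimage_def Int_def conj_commute)
    have 2: "{x \<in> space X. \<forall>l\<in>{..<i}. \<not> f l x = f i x} \<in> sets X"
      by (rule sets.sets_Collect_finite_All, rule sets.sets_Collect_neg,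
          rule eq[OF f f, unfolded pred_def], simp)
    have 3: "{x \<in> space X. x = f j (f i x)} \<in> sets X"
      by (rule eq[OF id ff, unfolded pred_def])
    have 4: "{x \<in> space X. \<forall>l\<in>{..<j}. \<not> f l (f i x) = x} \<in> sets X"
      by (rule sets.sets_Collect_finite_All, rule sets.sets_Collect_neg,
          rule eq[OF ff id, unfolded pred_def], simp)
    have "D i j = {x \<in> space X. (x, f i x) \<in> G} \<inter> {x \<in> space X. \<forall>l\<in>{..<i}. \<not> f l x = f i x} \<inter>
      {x \<in> space X. x = f j (f i x)} \<inter> {x \<in> space X. \<forall>l\<in>{..<j}. \<not> f l (f i x) = x}"
      unfolding D_def first_def by (intro set_eqI iffI; simp)
    then show ?thesis using 1 2 3 4 by (simp add: sets.Int)
  qed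
  define \<phi> where "\<phi> n = f (fst (prod_decode n))" for n
  define \<psi> where "\<psi> n = f (snd (prod_decode n))" for n
  define Dom where "Dom n = D (fst (prod_decode n)) (snd (prod_decode n))" for n
  have "enumerated_graph X G \<phi> \<psi> Dom \<kappa> d"
  proof
    show "\<phi> n \<in> X \<rightarrow>\<^sub>M X" "\<psi> n \<in> X \<rightarrow>\<^sub>M X" "Dom n \<in> sets X" for n
      unfolding \<phi>_def \<psi>_def Dom_def by (intro f D_sets)+
    show "\<psi> n (\<phi> n x) = x" "(x, \<phi> n x) \<in> G" if "x \<in> Dom n" for n x
      using that unfolding \<phi>_def \<psi>_def Dom_def D_def first_def by auto
    show "\<exists>!n. x \<in> Dom n \<and> \<phi> n x = y" if xy: "(x, y) \<in> G" for x y
    proof -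
      have "(y, x) \<in> G" using that sym by (auto dest: symD)
      obtain i where i: "first x y i" using first_ex[OF xy] ..
      obtain j where j: "first y x j" using first_ex[OF \<open>(y, x) \<in> G\<close>] ..
      have f_i: "f i x = y" and f_j: "f j y = x" using i j by (simp_all add: first_def)
      show ?thesis
      proof (rule ex1I[of _ "prod_encode (i, j)"])
        show "x \<in> Dom (prod_encode (i, j)) \<and> \<phi> (prod_encode (i, j)) x = y"
          using i j xy G_space[OF xy] by (simp add: Dom_def \<phi>_def D_def f_i)
        fix n assume n: "x \<in> Dom n \<and> \<phi> n x = y"
        obtain i' j' where n': "prod_decode n = (i', j')" by (cases "prod_decode n")
        have "first x y i'" "first y x j'"
          using n by (auto simp: Dom_def \<phi>_def D_def n')
        then have "i' = i" "j' = j" using first_unique[OF _ i] first_unique[OF _ j] by simp_all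
        then show "n = prod_encode (i, j)" using n' by (metis prod_decode_inverse)
      qed
    qed
  qed (use sym irr d' \<kappa> in auto)
  then show ?thesis by blast
qed

context enumerated_graph
begin

lemma G_space: "(x, y) \<in> G \<Longrightarrow> x \<in> space X \<and> y \<in> space X"
  using sets.sets_into_space[OF G_sets] by (auto simp: space_pair_measure)

lemma Dom_space: "x \<in> Dom n \<Longrightarrow> x \<in> space X"
  using sets.sets_into_space[OF Dom_sets] by blast

lemma finite_section: "R \<subseteq> G \<Longrightarrow> finite (R `` {x})"
  using G_degree[of x] by (meson Image_mono finite_subset order_refl)

lemma card_section_le: "R \<subseteq> G \<Longrightarrow> card (R `` {x}) \<le> deg"
  using G_degree[of x] by (meson Image_mono card_mono le_trans order_refl)

lemma converse_sub: "R \<subseteq> G \<Longrightarrow> R\<inverse> \<subseteq> G"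
  using G_sym by (auto dest: symD)

lemma converse_sets: "R \<in> sets (X \<Otimes>\<^sub>M X) \<Longrightarrow> R\<inverse> \<in> sets (X \<Otimes>\<^sub>M X)"
proof -
  assume R [measurable]: "R \<in> sets (X \<Otimes>\<^sub>M X)"
  have "R\<inverse> = {p \<in> space (X \<Otimes>\<^sub>M X). (snd p, fst p) \<in> R}"
    using sets.sets_into_space[OF R] by (auto simp: space_pair_measure)
  also have "\<dots> \<in> sets (X \<Otimes>\<^sub>M X)" by measurable
  finally show ?thesis .
qed

section \<open>Degrees and images through the partial injections\<close>

definition part :: "('a \<times> 'a) set \<Rightarrow> nat \<Rightarrow> 'a set" where
  "part R n = {x \<in> Dom n. (x, \<phi> n x) \<in> R}"

lemma part_sets [measurable]: "R \<in> sets (X \<Otimes>\<^sub>M X) \<Longrightarrow> part R n \<in> sets X"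
proof -
  assume [measurable]: "R \<in> sets (X \<Otimes>\<^sub>M X)"
  have "part R n = {x \<in> space X. x \<in> Dom n \<and> (x, \<phi> n x) \<in> R}"
    using Dom_space by (auto simp: part_def)
  also have "\<dots> \<in> sets X" by measurable
  finally show ?thesis .
qed

lemma part_sub: "part R n \<subseteq> Dom n" by (auto simp: part_def)

lemma \<phi>_image_sets:
  assumes [measurable]: "A \<in> sets X" and "A \<subseteq> Dom n" shows "\<phi> n ` A \<in> sets X"
proof -
  have [measurable]: "Measurable.pred X (\<lambda>y. \<phi> n (\<psi> n y) = y)"
    by (rule measurable_pred_eq[OF \<kappa>_measurable _ _ \<kappa>_inj]) simp_all
  have "\<phi> n ` A = {y \<in> space X. \<psi> n y \<in> A \<and> \<phi> n (\<psi> n y) = y}"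
  proof (intro equalityI subsetI)
    fix y assume "y \<in> \<phi> n ` A"
    then obtain x where x: "x \<in> A" "y = \<phi> n x" by blast
    then have "x \<in> Dom n" using assms(2) by blast
    then show "y \<in> {y \<in> space X. \<psi> n y \<in> A \<and> \<phi> n (\<psi> n y) = y}"
      using x \<psi>_\<phi> G_space[OF Dom_edge] by simp
  qed force
  also have "\<dots> \<in> sets X" by measurable
  finally show ?thesis .
qed

lemma ecount_out:
  assumes "R \<subseteq> G"
  shows "ecount (R `` {x}) = (\<Sum>n. indicator (part R n) x)"
proof -
  have "bij_betw (\<lambda>n. \<phi> n x) {n. x \<in> part R n} (R `` {x})"
  proof (rule bij_betw_imageI)
    show "inj_on (\<lambda>n. \<phi> n x) {n. x \<in> part R n}"
    proof (rule inj_onI)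
      fix n m assume "n \<in> {n. x \<in> part R n}" "m \<in> {n. x \<in> part R n}" "\<phi> n x = \<phi> m x"
      then have "x \<in> Dom n" "x \<in> Dom m" "\<phi> m x = \<phi> n x" by (auto simp: part_def)
      then show "n = m" using edge_unique[OF Dom_edge[of x n]] by blast
    qed
    show "(\<lambda>n. \<phi> n x) ` {n. x \<in> part R n} = R `` {x}"
    proof (intro equalityI subsetI)
      fix y assume "y \<in> R `` {x}"
      then have y: "(x, y) \<in> R" by simp
      then obtain n where "x \<in> Dom n" "\<phi> n x = y" using edge_unique assms by blast
      then show "y \<in> (\<lambda>n. \<phi> n x) ` {n. x \<in> part R n}" using y by (auto simp: part_def)
    qed (auto simp: part_def)
  qed
  from suminf_indicator_eq_ecount[OF this] show ?thesis by (simp add: indicator_def of_bool_def)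
qed

text \<open>The arcs into \<open>y\<close> are indexed by their tails \<open>\<psi> n y\<close>.
  This matches \<open>ecount_out\<close> term by term, the set \<open>part R n\<close> being
  replaced by its image, which is the form \<open>transport_converse\<close> needs.\<close>

lemma ecount_in:
  assumes "R \<subseteq> G"
  shows "ecount (R\<inverse> `` {y}) = (\<Sum>n. indicator (\<phi> n ` part R n) y)"
proof -
  have \<psi>: "\<psi> n y \<in> part R n \<and> \<phi> n (\<psi> n y) = y" if "y \<in> \<phi> n ` part R n" for n
    using that \<psi>_\<phi> by (auto simp: part_def)
  have "bij_betw (\<lambda>n. \<psi> n y) {n. y \<in> \<phi> n ` part R n} (R\<inverse> `` {y})"
  proof (rule bij_betw_imageI)
    show "inj_on (\<lambda>n. \<psi> n y) {n. y \<in> \<phi> n ` part R n}"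
    proof (rule inj_onI)
      fix n m assume "n \<in> {n. y \<in> \<phi> n ` part R n}" "m \<in> {n. y \<in> \<phi> n ` part R n}" "\<psi> n y = \<psi> m y"
      then have "\<psi> n y \<in> Dom n \<and> \<phi> n (\<psi> n y) = y" "\<psi> n y \<in> Dom m \<and> \<phi> m (\<psi> n y) = y"
        using \<psi>[of n] \<psi>[of m] part_sub by auto
      then show "n = m" using edge_unique[OF Dom_edge[of "\<psi> n y" n]] by auto
    qed
    show "(\<lambda>n. \<psi> n y) ` {n. y \<in> \<phi> n ` part R n} = R\<inverse> `` {y}"
    proof (intro equalityI subsetI)
      fix x assume "x \<in> (\<lambda>n. \<psi> n y) ` {n. y \<in> \<phi> n ` part R n}"
      then obtain n where "x = \<psi> n y" "y \<in> \<phi> n ` part R n" by blast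
      moreover from \<psi>[OF this(2)] have "(\<psi> n y, y) \<in> R" unfolding part_def by (elim conjE) simp
      ultimately show "x \<in> R\<inverse> `` {y}" by simp
    next
      fix x assume "x \<in> R\<inverse> `` {y}"
      then have "(x, y) \<in> R" by simp
      then obtain n where n: "x \<in> Dom n" "\<phi> n x = y" using edge_unique assms by blast
      then have "y \<in> \<phi> n ` part R n" using \<open>(x, y) \<in> R\<close> by (auto simp: part_def)
      moreover have "x = \<psi> n y" using n \<psi>_\<phi> by metis
      ultimately show "x \<in> (\<lambda>n. \<psi> n y) ` {n. y \<in> \<phi> n ` part R n}" by blast
    qed
  qed
  from suminf_indicator_eq_ecount[OF this] show ?thesis by (simp add: indicator_def of_bool_def)
qed

lemma ecount_section_measurable:
  assumes [measurable]: "R \<in> sets (X \<Otimes>\<^sub>M X)" and "R \<subseteq> G"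
  shows "(\<lambda>x. ecount (R `` {x})) \<in> borel_measurable X"
  unfolding ecount_out[OF assms(2)] by measurable

lemma card_section_measurable:
  assumes "R \<in> sets (X \<Otimes>\<^sub>M X)" and "R \<subseteq> G"
  shows "(\<lambda>x. card (R `` {x})) \<in> X \<rightarrow>\<^sub>M count_space UNIV"
proof -
  have [measurable]: "(\<lambda>x. ecount (R `` {x})) \<in> borel_measurable X"
    by (rule ecount_section_measurable[OF assms])
  have "(\<lambda>x. card (R `` {x})) -` {m} \<inter> space X = {x \<in> space X. ecount (R `` {x}) = of_nat m}" for m
    using finite_section[OF assms(2)] by (auto simp: ecount_finite)
  also have "\<dots> m \<in> sets X" for m by measurable
  finally show ?thesis
    by (subst measurable_count_space_eq2_countable) auto
qed

text \<open>Images of Borel sets need not be Borel in general; here the image is a countable union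
  of images under the injective \<open>\<phi> n\<close>.\<close>

lemma image_relation_sets:
  assumes "R \<in> sets (X \<Otimes>\<^sub>M X)" "R \<subseteq> G" "A \<in> sets X"
  shows "R `` A \<in> sets X"
proof -
  have "part R n \<inter> A \<in> sets X" for n
    by (rule sets.Int[OF part_sets[OF assms(1)] assms(3)])
  then have "(\<Union>n. \<phi> n ` (part R n \<inter> A)) \<in> sets X"
    using part_sub by (intro sets.countable_UN'' \<phi>_image_sets) auto
  also have "(\<Union>n. \<phi> n ` (part R n \<inter> A)) = R `` A"
  proof (intro equalityI subsetI)
    fix y assume "y \<in> R `` A"
    then obtain x where x: "x \<in> A" "(x, y) \<in> R" by blast
    then obtain n where "x \<in> Dom n" "\<phi> n x = y" using edge_unique assms(2) by blast
    then show "y \<in> (\<Union>n. \<phi> n ` (part R n \<inter> A))" using x by (auto simp: part_def)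
  qed (auto simp: part_def)
  finally show ?thesis .
qed

subsection \<open>Walks along the partial injections\<close>

definition walk :: "nat list \<Rightarrow> nat \<Rightarrow> 'a \<Rightarrow> 'a" where
  "walk w l = fold \<phi> (take l w)"

definition walk_dom :: "nat list \<Rightarrow> 'a set" where
  "walk_dom w = {x \<in> space X. \<forall>l<length w. walk w l x \<in> Dom (w ! l)}"

lemma walk_0 [simp]: "walk w 0 x = x" by (simp add: walk_def)

lemma walk_Suc: "l < length w \<Longrightarrow> walk w (Suc l) x = \<phi> (w ! l) (walk w l x)"
  by (simp add: walk_def take_Suc_conv_app_nth)

lemma walk_measurable [measurable]: "walk w l \<in> X \<rightarrow>\<^sub>M X"
proof -
  have "fold \<phi> v \<in> X \<rightarrow>\<^sub>M X" for v
  proof (induction v)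
    case (Cons a v)
    show ?case unfolding fold.simps by (rule measurable_comp[OF \<phi>_measurable Cons])
  qed (simp add: measurable_ident_sets id_def)
  then show ?thesis by (simp add: walk_def)
qed

lemma walk_dom_sets [measurable]: "walk_dom w \<in> sets X"
  unfolding walk_dom_def by measurable

lemma walk_in_Dom: "x \<in> walk_dom w \<Longrightarrow> l < length w \<Longrightarrow> walk w l x \<in> Dom (w ! l)"
  by (simp add: walk_dom_def)

lemma walk_space: "x \<in> walk_dom w \<Longrightarrow> walk w l x \<in> space X"
  using measurable_space[OF walk_measurable] by (auto simp: walk_dom_def)

lemma walk_edge:
  "x \<in> walk_dom w \<Longrightarrow> l < length w \<Longrightarrow> (walk w l x, walk w (Suc l) x) \<in> G"
  using Dom_edge walk_in_Dom by (simp add: walk_Suc)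

lemma inj_on_walk: "l \<le> length w \<Longrightarrow> inj_on (walk w l) (walk_dom w)"
proof (induction l)
  case (Suc l)
  show ?case
  proof (rule inj_onI)
    fix x y assume xy: "x \<in> walk_dom w" "y \<in> walk_dom w" "walk w (Suc l) x = walk w (Suc l) y"
    then have "\<phi> (w ! l) (walk w l x) = \<phi> (w ! l) (walk w l y)"
      using Suc.prems by (simp add: walk_Suc)
    moreover have "\<psi> (w ! l) (\<phi> (w ! l) (walk w l z)) = walk w l z" if "z \<in> walk_dom w" for z
      using walk_in_Dom[OF that, of l] Suc.prems by (simp add: \<psi>_\<phi>)
    ultimately have "walk w l x = walk w l y" using xy(1,2) by metis
    then show "x = y" using Suc xy by (auto dest: inj_onD)
  qed
qed (simp add: inj_on_def)

lemma walk_image_sets: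
  assumes "A \<in> sets X" "A \<subseteq> walk_dom w" "l \<le> length w"
  shows "walk w l ` A \<in> sets X"
  using assms(3)
proof (induction l)
  case (Suc l)
  have "walk w (Suc l) ` A = \<phi> (w ! l) ` (walk w l ` A)"
    using Suc.prems by (simp add: image_image walk_Suc)
  moreover have "walk w l ` A \<subseteq> Dom (w ! l)" using assms(2) Suc.prems walk_in_Dom by auto
  ultimately show ?case using \<phi>_image_sets Suc by simp
qed (use assms(1) in simp)


subsection \<open>Reversing disjoint walks\<close>

text \<open>Stricter than \<open>borel_orientation\<close>: each edge has exactly one direction.
  This is what makes a reversal change out-degrees by known amounts.\<close>

definition oriented :: "('a \<times> 'a) set \<Rightarrow> bool" where
  "oriented r \<longleftrightarrow> r \<in> sets (X \<Otimes>\<^sub>M X) \<and> r \<inter> r\<inverse> = {} \<and> r \<union> r\<inverse> = G"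

lemma oriented_sets: "oriented r \<Longrightarrow> r \<in> sets (X \<Otimes>\<^sub>M X)"
  by (simp add: oriented_def)

lemma oriented_sub: "oriented r \<Longrightarrow> r \<subseteq> G"
  by (auto simp: oriented_def)

lemma oriented_asym: "oriented r \<Longrightarrow> (u, v) \<in> r \<Longrightarrow> (v, u) \<notin> r"
  by (auto simp: oriented_def)

lemma oriented_total: "oriented r \<Longrightarrow> (u, v) \<in> G \<Longrightarrow> (u, v) \<in> r \<or> (v, u) \<in> r"
  unfolding oriented_def by blast

definition fwd :: "nat list \<Rightarrow> 'a set \<Rightarrow> ('a \<times> 'a) set" where
  "fwd w A = (\<Union>l<length w. (\<lambda>x. (walk w l x, walk w (Suc l) x)) ` A)"

definition flip :: "nat list \<Rightarrow> 'a set \<Rightarrow> ('a \<times> 'a) set \<Rightarrow> ('a \<times> 'a) set" where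
  "flip w A r = (r - fwd w A) \<union> (fwd w A)\<inverse>"

definition touched :: "nat list \<Rightarrow> 'a set \<Rightarrow> 'a set" where
  "touched w A = (\<Union>l\<le>length w. walk w l ` A)"

lemma fwd_iff: "(u, v) \<in> fwd w A \<longleftrightarrow> (\<exists>l<length w. \<exists>x\<in>A. u = walk w l x \<and> v = walk w (Suc l) x)"
  unfolding fwd_def by auto

text \<open>The arcs at position \<open>l\<close> are the part of the graph of
  \<open>\<phi> (w ! l)\<close> above the Borel set of \<open>l\<close>-th vertices.\<close>

lemma fwd_sets:
  assumes A: "A \<in> sets X" "A \<subseteq> walk_dom w"
  shows "fwd w A \<in> sets (X \<Otimes>\<^sub>M X)"
  unfolding fwd_def
proof (rule sets.finite_UN)
  fix l assume l: "l \<in> {..<length w}"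
  define B where "B = walk w l ` A"
  have B [measurable]: "B \<in> sets X"
    unfolding B_def using walk_image_sets[OF A] l by simp
  have "Measurable.pred (X \<Otimes>\<^sub>M X) (\<lambda>p. \<phi> (w ! l) (fst p) = snd p)"
    by (rule measurable_pred_eq[OF \<kappa>_measurable
          measurable_compose[OF measurable_fst \<phi>_measurable] measurable_snd \<kappa>_inj])
  then have "{p \<in> space (X \<Otimes>\<^sub>M X). \<phi> (w ! l) (fst p) = snd p} \<in> sets (X \<Otimes>\<^sub>M X)"
    by (simp add: pred_def)
  moreover have "B \<times> space X \<in> sets (X \<Otimes>\<^sub>M X)" by (intro pair_measureI B sets.top)
  ultimately have "(B \<times> space X) \<inter> {p \<in> space (X \<Otimes>\<^sub>M X). \<phi> (w ! l) (fst p) = snd p} \<in> sets (X \<Otimes>\<^sub>M X)"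
    by (rule sets.Int[rotated])
  also have "(B \<times> space X) \<inter> {p \<in> space (X \<Otimes>\<^sub>M X). \<phi> (w ! l) (fst p) = snd p} =
    (\<lambda>x. (walk w l x, walk w (Suc l) x)) ` A" (is "?L = ?R")
  proof (intro equalityI subsetI)
    fix p assume "p \<in> ?L"
    then show "p \<in> ?R" using l by (cases p) (auto simp: B_def walk_Suc image_iff)
  next
    fix p assume "p \<in> ?R"
    then obtain x where x: "x \<in> A" "p = (walk w l x, walk w (Suc l) x)" by blast
    then have "x \<in> walk_dom w" using A(2) by blast
    then show "p \<in> ?L"
      using x l walk_space[of x w] by (simp add: B_def walk_Suc space_pair_measure)
        (simp add: walk_Suc[symmetric])
  qed
  finally show "(\<lambda>x. (walk w l x, walk w (Suc l) x)) ` A \<in> sets (X \<Otimes>\<^sub>M X)" .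
qed simp

lemma touched_sets:
  assumes "A \<in> sets X" "A \<subseteq> walk_dom w" shows "touched w A \<in> sets X"
  unfolding touched_def using walk_image_sets[OF assms] by (intro sets.finite_UN) auto

lemma touchedI: "x \<in> A \<Longrightarrow> l \<le> length w \<Longrightarrow> walk w l x \<in> touched w A"
  unfolding touched_def by blast

lemma flip_untouched:
  assumes "v \<notin> touched w A"
  shows "(v, u) \<in> flip w A r \<longleftrightarrow> (v, u) \<in> r" "(u, v) \<in> flip w A r \<longleftrightarrow> (u, v) \<in> r"
proof -
  have "(v, u) \<notin> fwd w A" "(u, v) \<notin> fwd w A"
    using assms touchedI[of _ A _ w] by (auto simp: fwd_iff)
  then show "(v, u) \<in> flip w A r \<longleftrightarrow> (v, u) \<in> r" "(u, v) \<in> flip w A r \<longleftrightarrow> (u, v) \<in> r"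
    by (simp_all add: flip_def)
qed

lemma oriented_flip:
  assumes r: "oriented r" and A: "A \<in> sets X" "A \<subseteq> walk_dom w" and sub: "fwd w A \<subseteq> r"
  shows "oriented (flip w A r)"
proof -
  have "flip w A r \<in> sets (X \<Otimes>\<^sub>M X)"
    unfolding flip_def by (intro sets.Un sets.Diff converse_sets fwd_sets A oriented_sets[OF r])
  moreover have flip_iff: "(u, v) \<in> flip w A r \<longleftrightarrow> (u, v) \<in> r \<and> (u, v) \<notin> fwd w A \<or> (v, u) \<in> fwd w A" for u v
    by (simp add: flip_def)
  moreover have sub': "(u, v) \<in> fwd w A \<Longrightarrow> (u, v) \<in> r" for u v using sub by (rule subsetD)
  moreover have "flip w A r \<inter> (flip w A r)\<inverse> = {}"
  proof (rule equals0I)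
    fix p assume "p \<in> flip w A r \<inter> (flip w A r)\<inverse>"
    then obtain u v where "(u, v) \<in> flip w A r" "(v, u) \<in> flip w A r" by (cases p) auto
    then show False using oriented_asym[OF r, of u v] oriented_asym[OF r, of v u] sub'[of u v] sub'[of v u]
      unfolding flip_iff by argo
  qed
  moreover have "flip w A r \<union> (flip w A r)\<inverse> = r \<union> r\<inverse>"
  proof (rule set_eqI)
    fix p :: "'a \<times> 'a"
    obtain u v where "p = (u, v)" by (cases p)
    then show "p \<in> flip w A r \<union> (flip w A r)\<inverse> \<longleftrightarrow> p \<in> r \<union> r\<inverse>"
      using sub'[of u v] sub'[of v u] unfolding Un_iff by (simp add: flip_iff) argo
  qed
  ultimately show ?thesis using r unfolding oriented_def by simp
qed

text \<open>A reversal removes the forward arcs that leave \<open>v\<close> and adds the reverses of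
  those that enter it; asymmetry of \<open>r\<close> ensures that the added arcs are new. The
  additive form avoids truncated subtraction.\<close>

lemma card_flip:
  assumes r: "oriented r" and sub: "fwd w A \<subseteq> r"
  shows "card (flip w A r `` {v}) + card (fwd w A `` {v}) = card (r `` {v}) + card ((fwd w A)\<inverse> `` {v})"
proof -
  have fin: "finite (r `` {v})" using finite_section[OF oriented_sub[OF r]] .
  have sub': "fwd w A `` {v} \<subseteq> r `` {v}" using sub by blast
  have "(fwd w A)\<inverse> \<subseteq> G" using converse_sub sub oriented_sub[OF r] by blast
  then have fin': "finite ((fwd w A)\<inverse> `` {v})" by (rule finite_section)
  have "flip w A r `` {v} = (r `` {v} - fwd w A `` {v}) \<union> (fwd w A)\<inverse> `` {v}"
    by (rule set_eqI) (simp add: flip_def)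
  moreover have "(r `` {v} - fwd w A `` {v}) \<inter> (fwd w A)\<inverse> `` {v} = {}"
  proof (rule equals0I)
    fix u assume "u \<in> (r `` {v} - fwd w A `` {v}) \<inter> (fwd w A)\<inverse> `` {v}"
    then have "(v, u) \<in> r" "(u, v) \<in> fwd w A" by simp_all
    then show False using oriented_asym[OF r, of v u] subsetD[OF sub, of "(u, v)"] by simp
  qed
  ultimately have "card (flip w A r `` {v}) = card (r `` {v} - fwd w A `` {v}) + card ((fwd w A)\<inverse> `` {v})"
    using fin fin' by (simp add: card_Un_disjoint)
  moreover have "card (r `` {v} - fwd w A `` {v}) + card (fwd w A `` {v}) = card (r `` {v})"
    using card_Diff_subset[OF finite_subset[OF sub' fin] sub'] card_mono[OF fin sub'] by simp
  ultimately show ?thesis by simp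
qed

text \<open>Taking \<open>x = y\<close> also forbids a walk to meet itself.\<close>

definition disjoint_walks :: "nat list \<Rightarrow> 'a set \<Rightarrow> bool" where
  "disjoint_walks w A \<longleftrightarrow> (\<forall>x\<in>A. \<forall>y\<in>A. \<forall>l\<le>length w. \<forall>l'\<le>length w.
     walk w l x = walk w l' y \<longrightarrow> x = y \<and> l = l')"

lemma disjoint_walksD:
  "disjoint_walks w A \<Longrightarrow> x \<in> A \<Longrightarrow> y \<in> A \<Longrightarrow> l \<le> length w \<Longrightarrow> l' \<le> length w \<Longrightarrow>
    walk w l x = walk w l' y \<Longrightarrow> x = y \<and> l = l'"
  unfolding disjoint_walks_def by blast

text \<open>By disjointness at most one forward arc leaves and at most one enters each vertex, so
  the reversal moves one unit of out-degree from the start of each walk to its end.\<close>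

lemma card_flip_walk:
  assumes r: "oriented r" and sub: "fwd w A \<subseteq> r" and disj: "disjoint_walks w A"
    and x: "x \<in> A" and l: "l \<le> length w"
  shows "card (flip w A r `` {walk w l x}) + (if l < length w then 1 else 0) =
    card (r `` {walk w l x}) + (if 0 < l then 1 else 0)"
proof -
  have "fwd w A `` {walk w l x} = (if l < length w then {walk w (Suc l) x} else {})" (is "?L = ?R")
  proof (rule set_eqI)
    fix y
    have "y \<in> ?L \<longleftrightarrow> (\<exists>l'<length w. \<exists>x'\<in>A. walk w l x = walk w l' x' \<and> y = walk w (Suc l') x')"
      by (simp add: fwd_iff)
    also have "\<dots> \<longleftrightarrow> l < length w \<and> y = walk w (Suc l) x"
    proof
      assume "\<exists>l'<length w. \<exists>x'\<in>A. walk w l x = walk w l' x' \<and> y = walk w (Suc l') x'"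
      then obtain l' x' where *: "l' < length w" "x' \<in> A" "walk w l x = walk w l' x'" "y = walk w (Suc l') x'"
        by blast
      then have "x = x' \<and> l = l'" by (intro disjoint_walksD[OF disj x _ l]) simp_all
      then show "l < length w \<and> y = walk w (Suc l) x" using * by simp
    next
      assume "l < length w \<and> y = walk w (Suc l) x"
      then show "\<exists>l'<length w. \<exists>x'\<in>A. walk w l x = walk w l' x' \<and> y = walk w (Suc l') x'"
        using x by (intro exI[of _ l] conjI bexI[of _ x]) simp_all
    qed
    finally show "y \<in> ?L \<longleftrightarrow> y \<in> ?R" by simp
  qed
  moreover have "(fwd w A)\<inverse> `` {walk w l x} = (if 0 < l then {walk w (l - 1) x} else {})" (is "?L = ?R")
  proof (rule set_eqI)
    fix y
    have "y \<in> ?L \<longleftrightarrow> (\<exists>l'<length w. \<exists>x'\<in>A. y = walk w l' x' \<and> walk w l x = walk w (Suc l') x')"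
      by (simp add: fwd_iff)
    also have "\<dots> \<longleftrightarrow> 0 < l \<and> y = walk w (l - 1) x"
    proof
      assume "\<exists>l'<length w. \<exists>x'\<in>A. y = walk w l' x' \<and> walk w l x = walk w (Suc l') x'"
      then obtain l' x' where *: "l' < length w" "x' \<in> A" "walk w l x = walk w (Suc l') x'" "y = walk w l' x'"
        by blast
      then have "x = x' \<and> l = Suc l'" by (intro disjoint_walksD[OF disj x _ l]) simp_all
      then show "0 < l \<and> y = walk w (l - 1) x" using * by simp
    next
      assume *: "0 < l \<and> y = walk w (l - 1) x"
      then obtain m where "l = Suc m" by (cases l) auto
      then show "\<exists>l'<length w. \<exists>x'\<in>A. y = walk w l' x' \<and> walk w l x = walk w (Suc l') x'"
        using x l * by (intro exI[of _ m] conjI bexI[of _ x]) simp_all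
    qed
    finally show "y \<in> ?L \<longleftrightarrow> y \<in> ?R" by simp
  qed
  ultimately show ?thesis using card_flip[OF r sub, of "walk w l x"]
    by (cases "l < length w"; cases "0 < l") simp_all
qed

text \<open>The triple holds the word, the index of a colouring and the colours expected along the
  walk. There are countably many triples, each set of starting points is Borel, and prescribing
  distinct colours keeps the walks apart (\<open>starts_disjoint\<close>).\<close>

definition starts :: "nat \<Rightarrow> nat \<Rightarrow> nat list \<times> nat \<times> nat list \<Rightarrow> ('a \<times> 'a) set \<Rightarrow> 'a set" where
  "starts k n \<tau> r = (case \<tau> of (w, N, cs) \<Rightarrow>
     {x \<in> walk_dom w. length w \<le> n \<and> distinct cs \<and> length cs = Suc (length w) \<and>
        (\<forall>l\<le>length w. \<kappa> N (walk w l x) = cs ! l) \<and>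
        (\<forall>l<length w. (walk w l x, walk w (Suc l) x) \<in> r) \<and>
        k < card (r `` {x}) \<and> card (r `` {walk w (length w) x}) < k})"

lemma starts_sub: "starts k n \<tau> r \<subseteq> walk_dom (fst \<tau>)"
  by (auto simp: starts_def split: prod.splits)

lemma starts_sets:
  assumes r: "oriented r"
  shows "starts k n \<tau> r \<in> sets X"
proof -
  obtain w N cs where \<tau>: "\<tau> = (w, N, cs)" by (cases \<tau>)
  have c: "(\<lambda>x. card (r `` {x})) \<in> X \<rightarrow>\<^sub>M count_space UNIV"
    by (rule card_section_measurable[OF oriented_sets[OF r] oriented_sub[OF r]])
  have 1: "{x \<in> space X. \<kappa> N (walk w l x) = cs ! l} \<in> sets X" for l
  proof -
    have "(\<lambda>x. \<kappa> N (walk w l x)) \<in> X \<rightarrow>\<^sub>M count_space UNIV"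
      by (rule measurable_compose[OF walk_measurable \<kappa>_measurable])
    from measurable_sets[OF this, of "{cs ! l}"] show ?thesis
      by (simp add: vimage_def Int_def conj_commute)
  qed
  have 2: "{x \<in> space X. (walk w l x, walk w (Suc l) x) \<in> r} \<in> sets X" for l
  proof -
    have "(\<lambda>x. (walk w l x, walk w (Suc l) x)) \<in> X \<rightarrow>\<^sub>M X \<Otimes>\<^sub>M X"
      by (rule measurable_Pair[OF walk_measurable walk_measurable])
    from measurable_sets[OF this oriented_sets[OF r]] show ?thesis
      by (simp add: vimage_def Int_def conj_commute)
  qed
  have 3: "{x \<in> space X. k < card (r `` {x})} \<in> sets X"
    using measurable_sets[OF c, of "{k<..}"] by (simp add: vimage_def Int_def conj_commute)
  have 4: "{x \<in> space X. card (r `` {walk w (length w) x}) < k} \<in> sets X"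
  proof -
    have "(\<lambda>x. card (r `` {walk w (length w) x})) \<in> X \<rightarrow>\<^sub>M count_space UNIV"
      by (rule measurable_compose[OF walk_measurable c])
    from measurable_sets[OF this, of "{..<k}"] show ?thesis
      by (simp add: vimage_def Int_def conj_commute)
  qed
  have "starts k n \<tau> r = (if length w \<le> n \<and> distinct cs \<and> length cs = Suc (length w) then
     walk_dom w \<inter> {x \<in> space X. \<forall>l\<in>{..length w}. \<kappa> N (walk w l x) = cs ! l} \<inter>
     {x \<in> space X. \<forall>l\<in>{..<length w}. (walk w l x, walk w (Suc l) x) \<in> r} \<inter>
     {x \<in> space X. k < card (r `` {x})} \<inter> {x \<in> space X. card (r `` {walk w (length w) x}) < k} else {})"
    by (auto simp: starts_def \<tau> walk_dom_def)
  also have "\<dots> \<in> sets X"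
    using 3 4 by (auto intro!: sets.Int walk_dom_sets sets.sets_Collect_finite_All 1 2)
  finally show ?thesis .
qed

lemma starts_fwd: "fwd (fst \<tau>) (starts k n \<tau> r) \<subseteq> r"
  by (auto simp: starts_def fwd_def split: prod.splits)

text \<open>Distinct colours separate the positions of a walk, and injectivity of the partial maps
  separates the starting points.\<close>

lemma starts_disjoint: "disjoint_walks (fst \<tau>) (starts k n \<tau> r)"
  unfolding disjoint_walks_def
proof (intro ballI allI impI)
  obtain w N cs where \<tau>: "\<tau> = (w, N, cs)" by (cases \<tau>)
  fix x y l l'
  assume x: "x \<in> starts k n \<tau> r" and y: "y \<in> starts k n \<tau> r"
    and l: "l \<le> length (fst \<tau>)" "l' \<le> length (fst \<tau>)" and eq: "walk (fst \<tau>) l x = walk (fst \<tau>) l' y"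
  have "cs ! l = \<kappa> N (walk w l x)" "cs ! l' = \<kappa> N (walk w l' y)"
    using x y l by (auto simp: starts_def \<tau>)
  then have "cs ! l = cs ! l'" using eq by (simp add: \<tau>)
  moreover have "distinct cs" "length cs = Suc (length w)" using x by (auto simp: starts_def \<tau>)
  ultimately have "l = l'" using l by (simp add: \<tau> nth_eq_iff_index_eq)
  moreover have "x = y"
  proof (rule inj_onD[OF inj_on_walk])
    show "walk w l x = walk w l y" using eq \<open>l = l'\<close> by (simp add: \<tau>)
    show "l \<le> length w" using l by (simp add: \<tau>)
    show "x \<in> walk_dom w" "y \<in> walk_dom w" using x y starts_sub[of k n \<tau> r] by (auto simp: \<tau>)
  qed
  ultimately show "x = y \<and> l = l'" by blast
qed

section \<open>One round and the excess of out-degree over \<open>k\<close>\<close>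

definition round :: "nat \<Rightarrow> nat \<Rightarrow> nat list \<times> nat \<times> nat list \<Rightarrow> ('a \<times> 'a) set \<Rightarrow> ('a \<times> 'a) set" where
  "round k n \<tau> r = flip (fst \<tau>) (starts k n \<tau> r) r"

lemma oriented_round: "oriented r \<Longrightarrow> oriented (round k n \<tau> r)"
  unfolding round_def by (intro oriented_flip starts_sets starts_sub starts_fwd)

lemma card_round_starts:
  assumes "oriented r" "x \<in> starts k n \<tau> r"
  shows "Suc (card (round k n \<tau> r `` {x})) = card (r `` {x})"
proof -
  \<comment> \<open>For an empty word the start would also be the end, with out-degree both above
    and below \<open>k\<close>.\<close>
  have "fst \<tau> \<noteq> []"
    using assms(2) by (auto simp: starts_def split: prod.splits)
  then show ?thesis
    using card_flip_walk[OF assms(1) starts_fwd starts_disjoint assms(2), of 0] by (simp add: round_def)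
qed

text \<open>Truncated subtraction is intended: it gives the excess. A start is overfull and really
  loses a unit, inner vertices keep their out-degree, and an end has out-degree below
  \<open>k\<close>, so one more unit leaves its excess at 0.\<close>

lemma excess_round:
  assumes r: "oriented r"
  shows "(card (round k n \<tau> r `` {v}) - k) + (if v \<in> starts k n \<tau> r then 1 else 0) \<le> card (r `` {v}) - k"
proof (cases "v \<in> touched (fst \<tau>) (starts k n \<tau> r)")
  case False
  then have "v \<notin> starts k n \<tau> r" using touchedI[of v _ 0] by auto
  moreover have "round k n \<tau> r `` {v} = r `` {v}"
    unfolding round_def using flip_untouched(1)[OF False] by blast
  ultimately show ?thesis by simp
next
  case True
  then obtain x l where x: "x \<in> starts k n \<tau> r" and l: "l \<le> length (fst \<tau>)" and v: "v = walk (fst \<tau>) l x"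
    unfolding touched_def by blast
  have ends: "k < card (r `` {x})" "card (r `` {walk (fst \<tau>) (length (fst \<tau>)) x}) < k"
    using x by (auto simp: starts_def split: prod.splits)
  note step = card_flip_walk[OF r starts_fwd starts_disjoint x l, folded v round_def]
  consider "l = 0" | "0 < l" "l < length (fst \<tau>)" | "0 < l" "l = length (fst \<tau>)" using l by linarith
  then show ?thesis
  proof cases
    case 1
    then have "v = x" using v by simp
    then show ?thesis using card_round_starts[OF r x] ends x by simp
  next
    case 2
    have "v \<notin> starts k n \<tau> r"
    proof
      assume "v \<in> starts k n \<tau> r"
      from disjoint_walksD[OF starts_disjoint this x, of 0 l] show False using 2 v by simp
    qed
    then show ?thesis using step 2 by simp
  next
    case 3
    have "v \<notin> starts k n \<tau> r"
    proof
      assume "v \<in> starts k n \<tau> r"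
      from disjoint_walksD[OF starts_disjoint this x, of 0 l] show False using 3 v by simp
    qed
    then show ?thesis using step 3 ends v by simp
  qed
qed


subsection \<open>Exhausting the walks of bounded length\<close>

text \<open>Ignoring the second component of the decoded pair makes each move recur beyond every
  bound. A single visit would not do, since later reversals may open new walks for the same
  move.\<close>

definition move :: "nat \<Rightarrow> nat list \<times> nat \<times> nat list" where
  "move t = from_nat (fst (prod_decode t))"

lemma move_infinitely_often: "\<exists>t\<ge>T. move t = \<tau>"
  by (rule exI[of _ "prod_encode (to_nat \<tau>, T)"]) (simp add: move_def le_prod_encode_2)

primrec rounds :: "nat \<Rightarrow> nat \<Rightarrow> ('a \<times> 'a) set \<Rightarrow> nat \<Rightarrow> ('a \<times> 'a) set" where
  "rounds k n r 0 = r"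
| "rounds k n r (Suc t) = round k n (move t) (rounds k n r t)"

definition active :: "nat \<Rightarrow> nat \<Rightarrow> ('a \<times> 'a) set \<Rightarrow> nat \<Rightarrow> 'a set" where
  "active k n r t = starts k n (move t) (rounds k n r t)"

definition changed :: "nat \<Rightarrow> nat \<Rightarrow> ('a \<times> 'a) set \<Rightarrow> nat \<Rightarrow> 'a set" where
  "changed k n r t = touched (fst (move t)) (active k n r t)"

text \<open>An upper limit is visibly Borel. Starting from an oriented relation the rounds stabilise
  at each vertex (\<open>ex_stable\<close>), so it is then an honest pointwise limit.\<close>

definition limit :: "nat \<Rightarrow> nat \<Rightarrow> ('a \<times> 'a) set \<Rightarrow> ('a \<times> 'a) set" where
  "limit k n r = (\<Inter>T. \<Union>t\<in>{T..}. rounds k n r t)"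

lemma rounds_Suc_flip: "rounds k n r (Suc t) = flip (fst (move t)) (active k n r t) (rounds k n r t)"
  by (simp add: round_def active_def)

lemma oriented_rounds: "oriented r \<Longrightarrow> oriented (rounds k n r t)"
  by (induction t) (simp_all add: oriented_round)

lemma active_sub: "active k n r t \<subseteq> walk_dom (fst (move t))"
  unfolding active_def by (rule starts_sub)

lemma active_sets: "oriented r \<Longrightarrow> active k n r t \<in> sets X"
  unfolding active_def by (intro starts_sets oriented_rounds)

lemma changed_sets: "oriented r \<Longrightarrow> changed k n r t \<in> sets X"
  unfolding changed_def by (intro touched_sets active_sets active_sub)

lemma active_length: "x \<in> active k n r t \<Longrightarrow> length (fst (move t)) \<le> n"
  by (auto simp: active_def starts_def split: prod.splits)

text \<open>The excess acts as a potential: every walk started at \<open>v\<close> consumes one unit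
  of it.\<close>

lemma excess_rounds:
  assumes r: "oriented r"
  shows "(card (rounds k n r T `` {v}) - k) + (\<Sum>t<T. if v \<in> active k n r t then 1 else 0)
    \<le> card (r `` {v}) - k"
proof (induction T)
  case (Suc T)
  have "(card (rounds k n r (Suc T) `` {v}) - k) + (if v \<in> active k n r T then 1 else 0)
    \<le> card (rounds k n r T `` {v}) - k"
    using excess_round[OF oriented_rounds[OF r], of k n "move T" k n T v] by (simp add: active_def)
  then show ?case using Suc.IH unfolding sum.lessThan_Suc by linarith
qed simp

lemma finite_active:
  assumes r: "oriented r"
  shows "finite {t. v \<in> active k n r t}"
proof (rule ccontr)
  assume inf: "infinite {t. v \<in> active k n r t}"
  define m where "m = Suc (card (r `` {v}) - k)"
  obtain F where F: "F \<subseteq> {t. v \<in> active k n r t}" "finite F" "card F = m"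
    using infinite_arbitrarily_large[OF inf] by blast
  obtain T where T: "F \<subseteq> {..<T}" using F(2) finite_nat_bounded by blast
  have "m = (\<Sum>t\<in>F. if v \<in> active k n r t then 1 else 0)"
    using F by (simp add: subset_iff)
  also have "\<dots> \<le> (\<Sum>t<T. if v \<in> active k n r t then 1 else 0)"
    using T by (intro sum_mono2) auto
  finally show False using excess_rounds[OF r, of k n T v] by (simp add: m_def)
qed

text \<open>Adding \<open>Id\<close> turns paths of length exactly \<open>l\<close> into paths of
  length at most \<open>l\<close>.\<close>

definition near :: "nat \<Rightarrow> 'a \<Rightarrow> 'a set" where
  "near l v = ((G \<union> Id) ^^ l) `` {v}"

lemma finite_near: "finite (near l v)"
proof (induction l)
  case (Suc l)
  have "near (Suc l) v = (\<Union>u\<in>near l v. G `` {u} \<union> {u})"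
    unfolding near_def by (rule set_eqI) (simp add: relcomp_unfold, blast)
  then show ?case using Suc G_degree by simp
qed (simp add: near_def)

lemma near_mono: "l \<le> n \<Longrightarrow> near l v \<subseteq> near n v"
proof (induction n rule: dec_induct)
  case (step n)
  have "near n v \<subseteq> near (Suc n) v" unfolding near_def by (auto simp: relcomp_unfold)
  then show ?case using step by simp
qed simp

lemma start_near_walk:
  assumes "x \<in> walk_dom w" "l \<le> length w"
  shows "x \<in> near l (walk w l x)"
  using assms(2)
proof (induction l)
  case (Suc l)
  have "(walk w (Suc l) x, walk w l x) \<in> G \<union> Id"
    using symD[OF G_sym walk_edge[OF assms(1), of l]] Suc.prems by simp
  moreover have "(walk w l x, x) \<in> (G \<union> Id) ^^ l" using Suc unfolding near_def by simp
  ultimately have "(walk w (Suc l) x, x) \<in> (G \<union> Id) ^^ Suc l" by (rule relpow_Suc_I2)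
  then show ?case unfolding near_def by simp
qed (simp add: near_def)

text \<open>Only the finitely many vertices within distance \<open>n\<close> can start a walk through \<open>v\<close>, and each
  starts only finitely many, so the rounds are eventually constant around every vertex.\<close>

lemma finite_changed:
  assumes r: "oriented r"
  shows "finite {t. v \<in> changed k n r t}"
proof (rule finite_subset)
  show "{t. v \<in> changed k n r t} \<subseteq> (\<Union>x\<in>near n v. {t. x \<in> active k n r t})"
  proof
    fix t assume "t \<in> {t. v \<in> changed k n r t}"
    then obtain x l where x: "x \<in> active k n r t" and l: "l \<le> length (fst (move t))"
      and v: "v = walk (fst (move t)) l x"
      unfolding changed_def touched_def by blast
    have "x \<in> near l v" unfolding v by (rule start_near_walk[OF subsetD[OF active_sub x] l])
    moreover have "l \<le> n" using l active_length[OF x] by simp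
    ultimately have "x \<in> near n v" using near_mono by blast
    then show "t \<in> (\<Union>x\<in>near n v. {t. x \<in> active k n r t})" using x by blast
  qed
  show "finite (\<Union>x\<in>near n v. {t. x \<in> active k n r t})"
    by (intro finite_UN_I finite_near finite_active r)
qed

lemma rounds_unchanged:
  assumes "v \<notin> changed k n r t"
  shows "(v, u) \<in> rounds k n r (Suc t) \<longleftrightarrow> (v, u) \<in> rounds k n r t"
    "(u, v) \<in> rounds k n r (Suc t) \<longleftrightarrow> (u, v) \<in> rounds k n r t"
  by (unfold rounds_Suc_flip) (rule flip_untouched[OF assms[unfolded changed_def]])+

lemma rounds_constant:
  assumes "\<And>t. T \<le> t \<Longrightarrow> v \<notin> changed k n r t" "T \<le> t"
  shows "(v, u) \<in> rounds k n r t \<longleftrightarrow> (v, u) \<in> rounds k n r T"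
    "(u, v) \<in> rounds k n r t \<longleftrightarrow> (u, v) \<in> rounds k n r T"
proof -
  have "((v, u) \<in> rounds k n r t \<longleftrightarrow> (v, u) \<in> rounds k n r T) \<and>
      ((u, v) \<in> rounds k n r t \<longleftrightarrow> (u, v) \<in> rounds k n r T)"
    using assms(2)
  proof (induction t rule: dec_induct)
    case (step t)
    then show ?case using rounds_unchanged[OF assms(1)[OF step(1)], of u] by (simp del: rounds.simps)
  qed simp
  then show "(v, u) \<in> rounds k n r t \<longleftrightarrow> (v, u) \<in> rounds k n r T"
    "(u, v) \<in> rounds k n r t \<longleftrightarrow> (u, v) \<in> rounds k n r T" by simp_all
qed

lemma limit_eq_rounds:
  assumes "\<And>t. T \<le> t \<Longrightarrow> v \<notin> changed k n r t" "T \<le> t"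
  shows "(v, u) \<in> limit k n r \<longleftrightarrow> (v, u) \<in> rounds k n r t"
    "(u, v) \<in> limit k n r \<longleftrightarrow> (u, v) \<in> rounds k n r t"
proof -
  have lim: "p \<in> limit k n r \<longleftrightarrow> p \<in> rounds k n r T"
    if const: "\<And>t. T \<le> t \<Longrightarrow> p \<in> rounds k n r t \<longleftrightarrow> p \<in> rounds k n r T" for p
  proof
    assume "p \<in> limit k n r"
    then have "p \<in> (\<Union>t\<in>{T..}. rounds k n r t)" unfolding limit_def by (rule INT_D) simp
    then obtain t where "t \<in> {T..}" "p \<in> rounds k n r t" by (rule UN_E)
    then show "p \<in> rounds k n r T" using const[of t] by simp
  next
    assume p: "p \<in> rounds k n r T"
    have "p \<in> (\<Union>t\<in>{T'..}. rounds k n r t)" for T'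
      using p const[of "max T T'"] by (intro UN_I[of "max T T'"]) simp_all
    then show "p \<in> limit k n r" unfolding limit_def by (rule INT_I)
  qed
  have "(v, u) \<in> limit k n r \<longleftrightarrow> (v, u) \<in> rounds k n r T"
    by (rule lim) (rule rounds_constant(1)[OF assms(1)])
  then show "(v, u) \<in> limit k n r \<longleftrightarrow> (v, u) \<in> rounds k n r t"
    using rounds_constant(1)[OF assms, of u] by simp
  have "(u, v) \<in> limit k n r \<longleftrightarrow> (u, v) \<in> rounds k n r T"
    by (rule lim) (rule rounds_constant(2)[OF assms(1)])
  then show "(u, v) \<in> limit k n r \<longleftrightarrow> (u, v) \<in> rounds k n r t"
    using rounds_constant(2)[OF assms, of u] by simp
qed

lemma ex_stable:
  assumes r: "oriented r"
  shows "\<exists>T. \<forall>t\<ge>T. v \<notin> changed k n r t"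
proof -
  obtain T where "{t. v \<in> changed k n r t} \<subseteq> {..<T}"
    using finite_changed[OF r] finite_nat_bounded by blast
  then show ?thesis by (intro exI[of _ T]) auto
qed

text \<open>Asymmetry and totality concern one arc and its reverse. From some round on both are
  frozen, so the properties are inherited from that single round.\<close>

lemma oriented_limit:
  assumes r: "oriented r"
  shows "oriented (limit k n r)"
proof -
  have "(\<Union>t\<in>{T..}. rounds k n r t) \<in> sets (X \<Otimes>\<^sub>M X)" for T
    by (rule sets.countable_UN) (rule image_subsetI, rule oriented_sets[OF oriented_rounds[OF r]])
  then have meas: "limit k n r \<in> sets (X \<Otimes>\<^sub>M X)"
    unfolding limit_def by (intro sets.countable_INT) auto
  have agree: "\<exists>t. ((v, u) \<in> limit k n r \<longleftrightarrow> (v, u) \<in> rounds k n r t) \<and>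
      ((u, v) \<in> limit k n r \<longleftrightarrow> (u, v) \<in> rounds k n r t)" for u v
  proof -
    obtain T where "\<forall>t\<ge>T. v \<notin> changed k n r t" using ex_stable[OF r] by blast
    then show ?thesis using limit_eq_rounds[of T v k n r T u] by (intro exI[of _ T]) simp
  qed
  have "limit k n r \<inter> (limit k n r)\<inverse> = {}"
  proof (rule equals0I)
    fix p assume "p \<in> limit k n r \<inter> (limit k n r)\<inverse>"
    then obtain u v where "(v, u) \<in> limit k n r" "(u, v) \<in> limit k n r" by (cases p) auto
    then obtain t where "(v, u) \<in> rounds k n r t" "(u, v) \<in> rounds k n r t"
      using agree[of v u] by blast
    then show False using oriented_asym[OF oriented_rounds[OF r]] by blast
  qed
  moreover have "limit k n r \<union> (limit k n r)\<inverse> = G"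
  proof (rule set_eqI)
    fix p :: "'a \<times> 'a"
    obtain v u where p: "p = (v, u)" by (cases p)
    obtain t where t: "((v, u) \<in> limit k n r \<longleftrightarrow> (v, u) \<in> rounds k n r t) \<and>
      ((u, v) \<in> limit k n r \<longleftrightarrow> (u, v) \<in> rounds k n r t)"
      using agree by blast
    have "(v, u) \<in> G \<longleftrightarrow> (v, u) \<in> rounds k n r t \<or> (u, v) \<in> rounds k n r t"
      using oriented_rounds[OF r, of k n t] unfolding oriented_def by auto
    then show "p \<in> limit k n r \<union> (limit k n r)\<inverse> \<longleftrightarrow> p \<in> G" using t p by simp
  qed
  ultimately show ?thesis using meas unfolding oriented_def by blast
qed

text \<open>Injectivity of \<open>p\<close> matches the distinct colours that a move demands;
  \<open>shortest_walk_injective\<close> later reduces arbitrary walks to this case.\<close>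

definition no_augmenting :: "nat \<Rightarrow> nat \<Rightarrow> ('a \<times> 'a) set \<Rightarrow> bool" where
  "no_augmenting k n r \<longleftrightarrow> (\<forall>m\<le>n. \<forall>p. inj_on p {..m} \<longrightarrow> (\<forall>l<m. (p l, p (Suc l)) \<in> r) \<longrightarrow>
     k < card (r `` {p 0}) \<longrightarrow> k \<le> card (r `` {p m}))"

text \<open>An augmenting path of the limit is finite, so from some time on none of its vertices
  changes and it is a path of all later rounds. Its move recurs after that time and would lower the
  out-degree of its start, a contradiction.\<close>

lemma no_augmenting_limit:
  assumes r: "oriented r"
  shows "no_augmenting k n (limit k n r)"
  unfolding no_augmenting_def
proof (intro allI impI)
  fix m and p :: "nat \<Rightarrow> 'a"
  assume m: "m \<le> n" and inj: "inj_on p {..m}" and edges: "\<forall>l<m. (p l, p (Suc l)) \<in> limit k n r"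
    and start: "k < card (limit k n r `` {p 0})"
  show "k \<le> card (limit k n r `` {p m})"
  proof (rule ccontr)
    assume last: "\<not> k \<le> card (limit k n r `` {p m})"
    then have "m \<noteq> 0" using start by (intro notI) simp
    have G: "(p l, p (Suc l)) \<in> G" if "l < m" for l
      using edges that oriented_sub[OF oriented_limit[OF r]] by blast
    have "\<exists>i. p l \<in> Dom i \<and> \<phi> i (p l) = p (Suc l)" if "l < m" for l
      using edge_unique[OF G[OF that]] by (rule ex1_implies_ex)
    then obtain i where i: "\<And>l. l < m \<Longrightarrow> p l \<in> Dom (i l) \<and> \<phi> (i l) (p l) = p (Suc l)" by metis
    define w where "w = map i [0..<m]"
    have len: "length w = m" by (simp add: w_def)
    have walk: "walk w l (p 0) = p l" if "l \<le> m" for l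
      using that
    proof (induction l)
      case (Suc l)
      then show ?case using i[of l] by (simp add: walk_Suc len) (simp add: w_def)
    qed simp
    have space: "p l \<in> space X" if "l \<le> m" for l
    proof (cases l)
      case 0
      then show ?thesis using G_space[OF G[of 0]] \<open>m \<noteq> 0\<close> by simp
    next
      case (Suc l')
      then show ?thesis using G_space[OF G[of l']] that by simp
    qed
    have dom: "p 0 \<in> walk_dom w"
      unfolding walk_dom_def using space[of 0] i walk by (simp add: len) (simp add: w_def)
    \<comment> \<open>One colouring that is injective on the vertices of the path, together with
      injectivity of \<open>p\<close>, supplies the distinct colours of the move.\<close>
    obtain N where N: "inj_on (\<kappa> N) (p ` {..m})"
      using \<kappa>_inj[of "p ` {..m}"] space by auto
    define cs where "cs = map (\<lambda>l. \<kappa> N (p l)) [0..<Suc m]"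
    have "inj_on (\<lambda>l. \<kappa> N (p l)) {0..<Suc m}"
      using comp_inj_on[OF inj N] by (simp add: comp_def atLeast0LessThan lessThan_Suc_atMost)
    then have cs: "distinct cs" "length cs = Suc m" "\<And>l. l \<le> m \<Longrightarrow> cs ! l = \<kappa> N (p l)"
      unfolding cs_def by (simp_all add: distinct_map nth_map_upt del: upt_Suc)
    have "\<exists>T. \<forall>t\<ge>T. p l \<notin> changed k n r t" for l by (rule ex_stable[OF r])
    then obtain T where T: "\<And>l t. T l \<le> t \<Longrightarrow> p l \<notin> changed k n r t" by metis
    define T0 where "T0 = Max (T ` {..m})"
    have T0: "p l \<notin> changed k n r t" if "l \<le> m" "T0 \<le> t" for l t
    proof (rule T)
      have "T l \<le> T0" unfolding T0_def using that by (intro Max_ge) auto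
      then show "T l \<le> t" using that by simp
    qed
    obtain t where t: "T0 \<le> t" "move t = (w, N, cs)" using move_infinitely_often by blast
    have agree: "limit k n r `` {p l} = rounds k n r t' `` {p l}" if "l \<le> m" "T0 \<le> t'" for l t'
      using limit_eq_rounds(1)[OF T0[OF that(1)] that(2)] by (intro set_eqI) simp
    have "p 0 \<in> starts k n (w, N, cs) (rounds k n r t)"
    proof -
      have "(p l, p (Suc l)) \<in> rounds k n r t" if "l < m" for l
      proof -
        have "(p l, p (Suc l)) \<in> limit k n r \<longleftrightarrow> (p l, p (Suc l)) \<in> rounds k n r t"
          by (rule limit_eq_rounds(1)[OF _ t(1)]) (rule T0, use that in simp_all)
        then show ?thesis using edges that by simp
      qed
      moreover have "k < card (rounds k n r t `` {p 0})" using start agree[of 0 t] t(1) by simp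
      moreover have "card (rounds k n r t `` {p m}) < k" using last agree[of m t] t(1) by simp
      ultimately show ?thesis
        unfolding starts_def using dom m cs walk by (simp add: len)
    qed
    then have "Suc (card (rounds k n r (Suc t) `` {p 0})) = card (rounds k n r t `` {p 0})"
      using card_round_starts[OF oriented_rounds[OF r]] by (simp add: t(2))
    moreover have "rounds k n r (Suc t) `` {p 0} = rounds k n r t `` {p 0}"
      using agree[of 0 t] agree[of 0 "Suc t"] t(1) by simp
    ultimately show False by simp
  qed
qed


subsection \<open>Quasi-invariant measures\<close>

text \<open>The form in which the cocycle enters the estimates. A lower bound is implicit, since the
  reverse of every arc is carried by some index as well.\<close>

definition transport :: "'a measure \<Rightarrow> ennreal \<Rightarrow> bool" where
  "transport \<mu> C \<longleftrightarrow> sets \<mu> = sets X \<and>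
    (\<forall>n. \<forall>A\<in>sets X. A \<subseteq> Dom n \<longrightarrow> emeasure \<mu> (\<phi> n ` A) \<le> C * emeasure \<mu> A)"

lemma transport_sets: "transport \<mu> C \<Longrightarrow> sets \<mu> = sets X"
  by (simp add: transport_def)

lemma transport_step:
  "transport \<mu> C \<Longrightarrow> A \<in> sets X \<Longrightarrow> A \<subseteq> Dom n \<Longrightarrow> emeasure \<mu> (\<phi> n ` A) \<le> C * emeasure \<mu> A"
  by (simp add: transport_def)

lemma transport_walk:
  assumes \<mu>: "transport \<mu> C" and A: "A \<in> sets X" "A \<subseteq> walk_dom w" and "l \<le> length w"
  shows "emeasure \<mu> (walk w l ` A) \<le> C ^ l * emeasure \<mu> A"
  using assms(4)
proof (induction l)
  case (Suc l)
  have "walk w (Suc l) ` A = \<phi> (w ! l) ` (walk w l ` A)"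
    using Suc.prems by (simp add: image_image walk_Suc)
  moreover have "walk w l ` A \<subseteq> Dom (w ! l)"
    using A(2) Suc.prems walk_in_Dom by (intro image_subsetI) (simp add: subset_iff)
  ultimately have "emeasure \<mu> (walk w (Suc l) ` A) \<le> C * emeasure \<mu> (walk w l ` A)"
    using transport_step[OF \<mu> walk_image_sets[OF A]] Suc.prems by simp
  also have "\<dots> \<le> C * (C ^ l * emeasure \<mu> A)"
    using Suc by (intro mult_left_mono) simp_all
  finally show ?case by (simp add: mult.assoc)
qed simp

text \<open>Mass transport up to the factor \<open>C\<close>: both integrals split over the index
  \<open>n\<close>, and \<open>\<phi> n\<close> carries the tails of the arcs of index
  \<open>n\<close> onto their heads.\<close>

lemma transport_converse:
  assumes \<mu>: "transport \<mu> C" and R: "R \<in> sets (X \<Otimes>\<^sub>M X)" "R \<subseteq> G"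
  shows "(\<integral>\<^sup>+y. ecount (R\<inverse> `` {y}) \<partial>\<mu>) \<le> C * (\<integral>\<^sup>+x. ecount (R `` {x}) \<partial>\<mu>)"
proof -
  note s = transport_sets[OF \<mu>]
  have P: "part R n \<in> sets \<mu>" "\<phi> n ` part R n \<in> sets \<mu>" for n
    unfolding s using part_sets[OF R(1)] \<phi>_image_sets[OF part_sets[OF R(1)] part_sub] .
  have "(\<integral>\<^sup>+y. ecount (R\<inverse> `` {y}) \<partial>\<mu>) = (\<Sum>n. emeasure \<mu> (\<phi> n ` part R n))"
    unfolding ecount_in[OF R(2)] using P by (subst nn_integral_suminf) simp_all
  also have "\<dots> \<le> (\<Sum>n. C * emeasure \<mu> (part R n))"
    by (intro suminf_le transport_step[OF \<mu> part_sets[OF R(1)] part_sub] summableI)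
  also have "\<dots> = C * (\<Sum>n. emeasure \<mu> (part R n))" by (rule ennreal_suminf_cmult)
  also have "(\<Sum>n. emeasure \<mu> (part R n)) = (\<integral>\<^sup>+x. ecount (R `` {x}) \<partial>\<mu>)"
    unfolding ecount_out[OF R(2)] using P by (subst nn_integral_suminf) simp_all
  finally show ?thesis .
qed

definition overfull :: "nat \<Rightarrow> ('a \<times> 'a) set \<Rightarrow> 'a set" where
  "overfull k r = {x \<in> space X. k < card (r `` {x})}"

lemma overfull_sets:
  assumes r: "oriented r" shows "overfull k r \<in> sets X"
proof -
  have "(\<lambda>x. card (r `` {x})) \<in> X \<rightarrow>\<^sub>M count_space UNIV"
    by (rule card_section_measurable[OF oriented_sets[OF r] oriented_sub[OF r]])
  from measurable_sets[OF this, of "{k<..}"] show ?thesis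
    by (simp add: overfull_def vimage_def Int_def conj_commute)
qed

lemma limit_unchanged:
  assumes "v \<notin> (\<Union>t. changed k n r t)"
  shows "(v, u) \<in> limit k n r \<longleftrightarrow> (v, u) \<in> r"
  using limit_eq_rounds(1)[of 0 v k n r 0 u] assms by simp

text \<open>The initial excess bounds the number of activations; it is at most \<open>deg\<close>
  and vanishes off the overfull set.\<close>

lemma suminf_active_le:
  assumes r: "oriented r" and x: "x \<in> space X"
  shows "(\<Sum>t. indicator (active k n r t) x) \<le> of_nat deg * (indicator (overfull k r) x :: ennreal)"
proof (rule suminf_le_const[OF summableI])
  fix T
  have "(\<Sum>t<T. indicator (active k n r t) x) =
      (of_nat (\<Sum>t<T. if x \<in> active k n r t then 1 else 0) :: ennreal)"
    unfolding of_nat_sum by (intro sum.cong refl) (simp add: indicator_def)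
  also have "\<dots> \<le> of_nat (card (r `` {x}) - k)"
    using excess_rounds[OF r, of k n T x] by (intro of_nat_mono) linarith
  also have "\<dots> \<le> of_nat (deg * (if x \<in> overfull k r then 1 else 0))"
    using le_trans[OF diff_le_self card_section_le[OF oriented_sub[OF r], of x]] x
    by (intro of_nat_mono) (simp add: overfull_def)
  also have "\<dots> = of_nat deg * indicator (overfull k r) x" by (simp add: indicator_def)
  finally show "(\<Sum>t<T. indicator (active k n r t) x) \<le> of_nat deg * (indicator (overfull k r) x :: ennreal)" .
qed

text \<open>Round \<open>t\<close> alters only the \<open>l\<close>-th vertices,
  \<open>l \<le> n\<close>, of its walks, and these have measure at most \<open>C ^ l\<close> times
  that of the active set. Summed over \<open>t\<close>, the active sets count each start as often as
  it is used, which \<open>suminf_active_le\<close> controls.\<close>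

lemma emeasure_changed_le:
  assumes \<mu>: "transport \<mu> C" and r: "oriented r"
  shows "emeasure \<mu> (\<Union>t. changed k n r t) \<le>
    (\<Sum>l\<le>n. C ^ l) * (of_nat deg * emeasure \<mu> (overfull k r))"
proof -
  note s = transport_sets[OF \<mu>]
  have act: "active k n r t \<in> sets \<mu>" for t unfolding s by (rule active_sets[OF r])
  have one: "emeasure \<mu> (changed k n r t) \<le> (\<Sum>l\<le>n. C ^ l) * emeasure \<mu> (active k n r t)" for t
  proof (cases "active k n r t = {}")
    case True
    then have "changed k n r t = {}" by (simp add: changed_def touched_def)
    then show ?thesis by simp
  next
    case False
    define w where "w = fst (move t)"
    have A: "active k n r t \<in> sets X" "active k n r t \<subseteq> walk_dom w"
      unfolding w_def using active_sets[OF r] active_sub .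
    have len: "length w \<le> n" using False active_length unfolding w_def by blast
    have "emeasure \<mu> (changed k n r t) \<le> (\<Sum>l\<le>length w. emeasure \<mu> (walk w l ` active k n r t))"
      unfolding changed_def touched_def w_def[symmetric]
      by (rule emeasure_subadditive_finite) (auto simp: s intro: walk_image_sets[OF A])
    also have "\<dots> \<le> (\<Sum>l\<le>length w. C ^ l * emeasure \<mu> (active k n r t))"
      by (intro sum_mono transport_walk[OF \<mu> A]) simp
    also have "\<dots> \<le> (\<Sum>l\<le>n. C ^ l * emeasure \<mu> (active k n r t))"
      using len by (intro sum_mono2) auto
    also have "\<dots> = (\<Sum>l\<le>n. C ^ l) * emeasure \<mu> (active k n r t)" by (simp add: sum_distrib_right)
    finally show ?thesis .
  qed
  have "emeasure \<mu> (\<Union>t. changed k n r t) \<le> (\<Sum>t. emeasure \<mu> (changed k n r t))"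
    by (rule emeasure_subadditive_countably) (use changed_sets[OF r] s in blast)
  also have "\<dots> \<le> (\<Sum>t. (\<Sum>l\<le>n. C ^ l) * emeasure \<mu> (active k n r t))"
    by (intro suminf_le one summableI)
  also have "\<dots> = (\<Sum>l\<le>n. C ^ l) * (\<Sum>t. emeasure \<mu> (active k n r t))" by (rule ennreal_suminf_cmult)
  also have "(\<Sum>t. emeasure \<mu> (active k n r t)) = (\<integral>\<^sup>+x. (\<Sum>t. indicator (active k n r t) x) \<partial>\<mu>)"
    using act by (subst nn_integral_suminf) simp_all
  also have "\<dots> \<le> (\<integral>\<^sup>+x. of_nat deg * indicator (overfull k r) x \<partial>\<mu>)"
    by (intro nn_integral_mono suminf_active_le r) (simp add: sets_eq_imp_space_eq[OF s])
  also have "\<dots> = of_nat deg * emeasure \<mu> (overfull k r)"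
    by (rule nn_integral_cmult_indicator) (simp add: s overfull_sets r)
  finally show ?thesis by (simp add: mult_left_mono)
qed

section \<open>Growth of reachable sets and decay of the overfull set\<close>

primrec reach :: "('a \<times> 'a) set \<Rightarrow> 'a set \<Rightarrow> nat \<Rightarrow> 'a set" where
  "reach r A 0 = A"
| "reach r A (Suc i) = reach r A i \<union> r `` reach r A i"

lemma reach_sets:
  assumes "oriented r" "A \<in> sets X" shows "reach r A i \<in> sets X"
proof (induction i)
  case (Suc i)
  then show ?case
    using image_relation_sets[OF oriented_sets[OF assms(1)] oriented_sub[OF assms(1)] Suc] by simp
qed (use assms(2) in simp)

lemma reach_relpow: "y \<in> reach r A i \<Longrightarrow> \<exists>x\<in>A. \<exists>l\<le>i. (x, y) \<in> r ^^ l"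
proof (induction i arbitrary: y)
  case 0
  then show ?case by (intro bexI[of _ y] exI[of _ 0]) simp_all
next
  case (Suc i)
  consider "y \<in> reach r A i" | z where "z \<in> reach r A i" "(z, y) \<in> r" using Suc.prems by auto
  then show ?case
  proof cases
    case 1
    then show ?thesis using Suc.IH le_SucI by blast
  next
    case 2
    obtain x l where xl: "x \<in> A" "l \<le> i" "(x, z) \<in> r ^^ l" using Suc.IH[OF 2(1)] by blast
    then have "(x, y) \<in> r ^^ Suc l" using 2(2) by (intro relpow_Suc_I)
    then show ?thesis using xl by (intro bexI[of _ x] exI[of _ "Suc l"]) simp_all
  qed
qed

text \<open>A walk of least length repeats no vertex, since cutting out the loop would shorten
  it.\<close>

lemma shortest_walk_injective:
  assumes "(x, y) \<in> r ^^ l"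
  obtains f m where "m \<le> l" "f 0 = x" "f m = y" "\<forall>i<m. (f i, f (Suc i)) \<in> r" "inj_on f {..m}"
proof -
  define m where "m = (LEAST l. (x, y) \<in> r ^^ l)"
  have m: "(x, y) \<in> r ^^ m" unfolding m_def using assms by (rule LeastI)
  have least: "m \<le> j" if "(x, y) \<in> r ^^ j" for j unfolding m_def using that by (rule Least_le)
  obtain f where f: "f 0 = x" "f m = y" "\<forall>i<m. (f i, f (Suc i)) \<in> r"
    using m unfolding relpow_fun_conv by blast
  have "inj_on f {..m}"
  proof (rule linorder_inj_onI)
    fix i j assume ij: "i < j" "i \<in> {..m}" "j \<in> {..m}"
    show "f i \<noteq> f j"
    proof
      assume eq: "f i = f j"
      have "(x, f i) \<in> r ^^ i"
        unfolding relpow_fun_conv using f ij by (intro exI[of _ f]) simp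
      moreover have "(f j, y) \<in> r ^^ (m - j)"
        unfolding relpow_fun_conv using f ij by (intro exI[of _ "\<lambda>a. f (j + a)"]) simp
      ultimately have "(x, y) \<in> r ^^ i O r ^^ (m - j)" using eq by auto
      then have "(x, y) \<in> r ^^ (i + (m - j))" by (simp add: relpow_add)
      then show False using least ij by fastforce
    qed
  qed auto
  then show thesis using that[OF least[OF assms] f] by blast
qed

lemma reach_overfull:
  assumes "no_augmenting k n r" "y \<in> reach r (overfull k r) i" "i \<le> n"
  shows "k \<le> card (r `` {y})"
proof -
  obtain x l where x: "x \<in> overfull k r" "l \<le> i" "(x, y) \<in> r ^^ l"
    using reach_relpow[OF assms(2)] by blast
  obtain f m where f: "m \<le> l" "f 0 = x" "f m = y" "\<forall>i<m. (f i, f (Suc i)) \<in> r" "inj_on f {..m}"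
    by (rule shortest_walk_injective[OF x(3)])
  have "m \<le> n" using f x assms by linarith
  moreover have "k < card (r `` {f 0})" using x f by (simp add: overfull_def)
  ultimately have "k \<le> card (r `` {f m})"
    using assms(1) f unfolding no_augmenting_def by blast
  then show ?thesis using f by simp
qed

text \<open>By quasi-invariance the masses of out-edges and in-edges inside \<open>A\<close> differ by a factor of at
  most \<open>C\<close>, so out-edges carry at most the share \<open>C / (1 + C) \<le> C / 2\<close> of the total.\<close>

lemma inner_edges_le:
  assumes \<mu>: "transport \<mu> C" and C: "1 \<le> C" and r: "oriented r" and A: "A \<in> sets X"
    and a: "(\<integral>\<^sup>+x\<in>A. ecount (G `` {x} \<inter> A) \<partial>\<mu>) \<le> 2 * (a * emeasure \<mu> A)"
  shows "(\<integral>\<^sup>+x. ecount ((r \<inter> A \<times> A) `` {x}) \<partial>\<mu>) \<le> C * a * emeasure \<mu> A"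
proof -
  note s = transport_sets[OF \<mu>]
  define R where "R = r \<inter> A \<times> A"
  have R: "R \<in> sets (X \<Otimes>\<^sub>M X)" "R \<subseteq> G"
    unfolding R_def using oriented_sets[OF r] oriented_sub[OF r] A by auto
  have R': "R\<inverse> \<in> sets (X \<Otimes>\<^sub>M X)" "R\<inverse> \<subseteq> G" using converse_sets[OF R(1)] converse_sub[OF R(2)] .
  have meas: "(\<lambda>x. ecount (R `` {x})) \<in> borel_measurable \<mu>" "(\<lambda>x. ecount (R\<inverse> `` {x})) \<in> borel_measurable \<mu>"
    using ecount_section_measurable[OF R] ecount_section_measurable[OF R'] measurable_cong_sets[OF s refl]
    by auto
  define I where "I = (\<integral>\<^sup>+x. ecount (R `` {x}) \<partial>\<mu>)"
  define J where "J = (\<integral>\<^sup>+x. ecount (R\<inverse> `` {x}) \<partial>\<mu>)"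
  have point: "ecount (R `` {x}) + ecount (R\<inverse> `` {x}) = ecount (G `` {x} \<inter> A) * indicator A x" for x
  proof (cases "x \<in> A")
    case True
    have "R `` {x} \<inter> R\<inverse> `` {x} = {}"
      unfolding R_def using oriented_asym[OF r] by auto
    moreover have "R `` {x} \<union> R\<inverse> `` {x} = G `` {x} \<inter> A"
    proof (rule set_eqI)
      fix y
      have "(x, y) \<in> G \<longleftrightarrow> (x, y) \<in> r \<or> (y, x) \<in> r" using r unfolding oriented_def by auto
      then show "y \<in> R `` {x} \<union> R\<inverse> `` {x} \<longleftrightarrow> y \<in> G `` {x} \<inter> A" using True by (auto simp: R_def)
    qed
    ultimately have "card (G `` {x} \<inter> A) = card (R `` {x}) + card (R\<inverse> `` {x})"
      using card_Un_disjoint[OF finite_section[OF R(2)] finite_section[OF R'(2)]] by metis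
    then show ?thesis
      using True finite_section[OF R(2), of x] finite_section[OF R'(2), of x] G_degree[of x]
      by (simp add: ecount_finite)
  next
    case False
    then have "R `` {x} = {}" "R\<inverse> `` {x} = {}" by (auto simp: R_def)
    then show ?thesis using False by (simp add: ecount_def)
  qed
  have "I + J = (\<integral>\<^sup>+x. ecount (R `` {x}) + ecount (R\<inverse> `` {x}) \<partial>\<mu>)"
    unfolding I_def J_def using meas by (simp add: nn_integral_add)
  also have "\<dots> \<le> 2 * (a * emeasure \<mu> A)" using a by (simp add: point)
  finally have IJ: "I + J \<le> 2 * (a * emeasure \<mu> A)" .
  have "I \<le> C * J"
    unfolding I_def J_def using transport_converse[OF \<mu> R'] by simp
  moreover have "I \<le> C * I" using mult_right_mono[OF C, of I] by simp
  ultimately have "2 * I \<le> C * (I + J)"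
    using add_mono[of I "C * I" I "C * J"] by (simp add: mult_2 distrib_left)
  also have "\<dots> \<le> C * (2 * (a * emeasure \<mu> A))" by (intro mult_left_mono IJ) simp
  also have "\<dots> = 2 * (C * a * emeasure \<mu> A)" by (simp add: mult_ac)
  finally have "I \<le> C * a * emeasure \<mu> A"
    by (subst (asm) ennreal_mult_le_mult_iff) simp_all
  then show ?thesis by (simp add: I_def R_def)
qed

text \<open>Vertices of the \<open>i\<close>-th reachable set have out-degree at least
  \<open>k\<close>, and their out-arcs stay inside the next reachable set, where
  \<open>inner_edges_le\<close> bounds the arcs. Each step thus gains a factor
  \<open>C * a / k\<close>, written without division. The range extends to \<open>Suc n\<close>
  because the step to \<open>Suc i\<close> uses \<open>no_augmenting\<close> only up to distance
  \<open>i\<close>.\<close>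

lemma overfull_decay:
  assumes \<mu>: "transport \<mu> C" and C: "1 \<le> C" and r: "oriented r" and na: "no_augmenting k n r"
    and a: "\<And>A. A \<in> sets X \<Longrightarrow> (\<integral>\<^sup>+x\<in>A. ecount (G `` {x} \<inter> A) \<partial>\<mu>) \<le> 2 * (a * emeasure \<mu> A)"
    and i: "i \<le> Suc n"
  shows "of_nat k ^ i * emeasure \<mu> (overfull k r) \<le> (C * a) ^ i * emeasure \<mu> (reach r (overfull k r) i)"
  using i
proof (induction i)
  case (Suc i)
  note s = transport_sets[OF \<mu>]
  let ?A = "reach r (overfull k r)"
  have A: "?A j \<in> sets X" for j by (rule reach_sets[OF r overfull_sets[OF r]])
  have "of_nat k * emeasure \<mu> (?A i) = (\<integral>\<^sup>+x. of_nat k * indicator (?A i) x \<partial>\<mu>)"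
    using A by (subst nn_integral_cmult_indicator) (simp_all add: s)
  also have "\<dots> \<le> (\<integral>\<^sup>+x. ecount ((r \<inter> ?A (Suc i) \<times> ?A (Suc i)) `` {x}) \<partial>\<mu>)"
  proof (rule nn_integral_mono)
    fix x
    show "of_nat k * indicator (?A i) x \<le> ecount ((r \<inter> ?A (Suc i) \<times> ?A (Suc i)) `` {x})"
    proof (cases "x \<in> ?A i")
      case True
      then have "(r \<inter> ?A (Suc i) \<times> ?A (Suc i)) `` {x} = r `` {x}" by auto
      moreover have "k \<le> card (r `` {x})" using reach_overfull[OF na True] Suc.prems by simp
      ultimately show ?thesis
        using True finite_section[OF oriented_sub[OF r], of x] by (simp add: ecount_finite)
    qed simp
  qed
  also have "\<dots> \<le> C * a * emeasure \<mu> (?A (Suc i))"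
    by (rule inner_edges_le[OF \<mu> C r A a[OF A]])
  finally have step: "of_nat k * emeasure \<mu> (?A i) \<le> C * a * emeasure \<mu> (?A (Suc i))" .
  have "of_nat k ^ Suc i * emeasure \<mu> (overfull k r) = of_nat k * (of_nat k ^ i * emeasure \<mu> (overfull k r))"
    by (simp add: mult.assoc)
  also have "\<dots> \<le> of_nat k * ((C * a) ^ i * emeasure \<mu> (?A i))"
    using Suc by (intro mult_left_mono) simp_all
  also have "\<dots> = (C * a) ^ i * (of_nat k * emeasure \<mu> (?A i))" by (simp only: mult_ac)
  also have "\<dots> \<le> (C * a) ^ i * (C * a * emeasure \<mu> (?A (Suc i)))"
    by (intro mult_left_mono step) simp
  also have "\<dots> = (C * a) ^ Suc i * emeasure \<mu> (?A (Suc i))" by (simp only: power_Suc mult_ac)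
  finally show ?case .
qed simp


subsection \<open>The limit orientation\<close>

text \<open>Each edge points to the endpoint whose sequence of colours is lexicographically larger.
  The endpoints are distinct by irreflexivity, so some colouring tells them apart, and the place of
  the first difference is a Borel condition.\<close>

lemma ex_oriented: "\<exists>r. oriented r"
proof -
  define less where "less N = {p \<in> space (X \<Otimes>\<^sub>M X).
    (\<forall>j\<in>{..<N}. \<kappa> j (fst p) = \<kappa> j (snd p)) \<and> \<kappa> N (fst p) < \<kappa> N (snd p)}" for N
  define r where "r = G \<inter> (\<Union>N. less N)"
  have less_iff: "(x, y) \<in> less N \<longleftrightarrow> x \<in> space X \<and> y \<in> space X \<and>
      (\<forall>j<N. \<kappa> j x = \<kappa> j y) \<and> \<kappa> N x < \<kappa> N y" for x y N
    by (auto simp: less_def space_pair_measure)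
  have "less N \<in> sets (X \<Otimes>\<^sub>M X)" for N
  proof -
    have f: "(\<lambda>p. \<kappa> j (fst p)) \<in> (X \<Otimes>\<^sub>M X) \<rightarrow>\<^sub>M (borel :: nat measure)"
      and g: "(\<lambda>p. \<kappa> j (snd p)) \<in> (X \<Otimes>\<^sub>M X) \<rightarrow>\<^sub>M (borel :: nat measure)" for j
      unfolding measurable_borel_nat_eq
      by (rule measurable_compose[OF measurable_fst \<kappa>_measurable],
          rule measurable_compose[OF measurable_snd \<kappa>_measurable])
    show ?thesis
      unfolding less_def
      by (intro sets.sets_Collect_conj sets.sets_Collect_finite_All
          borel_measurable_eq[OF f g] borel_measurable_less[OF f g]) simp
  qed
  then have "(\<Union>N. less N) \<in> sets (X \<Otimes>\<^sub>M X)" by (intro sets.countable_UN'') simp_all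
  then have "r \<in> sets (X \<Otimes>\<^sub>M X)" unfolding r_def by (intro sets.Int G_sets)
  moreover have "r \<inter> r\<inverse> = {}"
  proof (rule equals0I)
    fix p assume "p \<in> r \<inter> r\<inverse>"
    then obtain x y N N' where "(x, y) \<in> less N" "(y, x) \<in> less N'"
      unfolding r_def by (cases p) auto
    then have "\<forall>j<N. \<kappa> j x = \<kappa> j y" "\<kappa> N x < \<kappa> N y" "\<forall>j<N'. \<kappa> j y = \<kappa> j x" "\<kappa> N' y < \<kappa> N' x"
      unfolding less_iff by simp_all
    then show False by (cases rule: linorder_cases[of N N']) auto
  qed
  moreover have "r \<union> r\<inverse> = G"
  proof (rule set_eqI)
    fix p :: "'a \<times> 'a"
    obtain x y where p: "p = (x, y)" by (cases p)
    have "(x, y) \<in> r \<or> (y, x) \<in> r" if G: "(x, y) \<in> G"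
    proof -
      have "x \<noteq> y" using G G_irrefl by (auto simp: irrefl_def)
      have sp: "x \<in> space X" "y \<in> space X" using G_space[OF G] by simp_all
      obtain M where "inj_on (\<kappa> M) {x, y}" using \<kappa>_inj[of "{x, y}"] sp by auto
      then have M: "\<kappa> M x \<noteq> \<kappa> M y" using \<open>x \<noteq> y\<close> by (auto dest: inj_onD)
      define N where "N = (LEAST N. \<kappa> N x \<noteq> \<kappa> N y)"
      have N: "\<kappa> N x \<noteq> \<kappa> N y" unfolding N_def by (rule LeastI[of _ M]) (rule M)
      have before: "\<kappa> j x = \<kappa> j y" if "j < N" for j
        using not_less_Least[of j "\<lambda>N. \<kappa> N x \<noteq> \<kappa> N y"] that unfolding N_def by simp
      have "(x, y) \<in> less N \<or> (y, x) \<in> less N"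
        unfolding less_iff using N before sp by (simp add: neq_iff)
      then show ?thesis using G symD[OF G_sym G] unfolding r_def by blast
    qed
    moreover have "(x, y) \<in> G" if "(x, y) \<in> r \<or> (y, x) \<in> r"
      using that symD[OF G_sym] unfolding r_def by blast
    ultimately show "p \<in> r \<union> r\<inverse> \<longleftrightarrow> p \<in> G" unfolding p by simp argo
  qed
  ultimately show ?thesis unfolding oriented_def by blast
qed

section \<open>Iterated stages and their upper limit\<close>

primrec stage :: "nat \<Rightarrow> nat \<Rightarrow> ('a \<times> 'a) set" where
  "stage k 0 = (SOME r. oriented r)"
| "stage k (Suc n) = limit k n (stage k n)"

definition final :: "nat \<Rightarrow> ('a \<times> 'a) set" where
  "final k = (\<Inter>T. \<Union>n\<in>{T..}. stage k n)"

lemma oriented_stage: "oriented (stage k n)"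
proof (induction n)
  case 0
  show ?case using ex_oriented by (simp add: someI_ex)
qed (simp add: oriented_limit)

lemma final_sub: "final k \<subseteq> G"
  using oriented_sub[OF oriented_stage] unfolding final_def by blast

lemma final_sets: "final k \<in> sets (X \<Otimes>\<^sub>M X)"
proof -
  have "(\<Union>n\<in>{T..}. stage k n) \<in> sets (X \<Otimes>\<^sub>M X)" for T
    by (rule sets.countable_UN) (rule image_subsetI, rule oriented_sets[OF oriented_stage])
  then show ?thesis unfolding final_def by (intro sets.countable_INT) auto
qed

lemma mem_final_iff: "p \<in> final k \<longleftrightarrow> (\<forall>T. \<exists>n\<ge>T. p \<in> stage k n)"
  unfolding final_def by auto

text \<open>The stages may fail to converge, and then both directions of an edge may survive, which
  \<open>orientation\<close> permits. Both cannot be lost: if one is absent from some stage on, the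
  other is present from there on.\<close>

lemma borel_orientation_final: "borel_orientation X G (final k)"
  unfolding borel_orientation_def orientation_def
proof (intro conjI ballI)
  show "final k \<subseteq> space X \<times> space X"
  proof
    fix p assume "p \<in> final k"
    from subsetD[OF final_sub this] show "p \<in> space X \<times> space X"
      using G_space[of "fst p" "snd p"] by (cases p) simp
  qed
  show "final k \<in> sets (X \<Otimes>\<^sub>M X)" by (rule final_sets)
  fix x y
  have "(x, y) \<in> final k \<or> (y, x) \<in> final k" if G: "(x, y) \<in> G"
  proof (cases "(x, y) \<in> final k")
    case False
    then obtain T where "\<forall>n\<ge>T. (x, y) \<notin> stage k n" unfolding mem_final_iff by auto
    then have T: "(x, y) \<notin> stage k n" if "T \<le> n" for n using that by simp
    have "(y, x) \<in> stage k n" if "T \<le> n" for n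
      using oriented_total[OF oriented_stage G, of k n] T[OF that] by simp
    then have "\<exists>n\<ge>T'. (y, x) \<in> stage k n" for T' by (intro exI[of _ "max T T'"]) simp
    then have "(y, x) \<in> final k" unfolding mem_final_iff by (rule allI)
    then show ?thesis ..
  qed simp
  moreover have "(x, y) \<in> G" if "(x, y) \<in> final k \<or> (y, x) \<in> final k"
    using that subsetD[OF final_sub] symD[OF G_sym] by metis
  ultimately show "(x, y) \<in> G \<longleftrightarrow> (x, y) \<in> final k \<or> (y, x) \<in> final k" by argo
qed

definition bad :: "nat \<Rightarrow> nat \<Rightarrow> 'a set" where
  "bad k n = (\<Union>t. changed k n (stage k n) t) \<union> overfull k (stage k n)"

lemma bad_sets: "bad k n \<in> sets X"
  unfolding bad_def
  by (intro sets.Un overfull_sets sets.countable_UN'' changed_sets oriented_stage) simp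

text \<open>A vertex outside the upper limit is altered by no late stage, so its out-arcs in
  \<open>final k\<close> are those of a late stage, in which it is not overfull.\<close>

lemma overfull_final: "overfull k (final k) \<subseteq> limsup (bad k)"
proof
  fix x assume x: "x \<in> overfull k (final k)"
  show "x \<in> limsup (bad k)"
  proof (rule ccontr)
    assume "x \<notin> limsup (bad k)"
    then have "\<exists>T. \<forall>n\<ge>T. x \<notin> bad k n"
      by (simp add: mem_limsup_iff frequently_def eventually_sequentially)
    then obtain T where "\<forall>n\<ge>T. x \<notin> bad k n" ..
    then have T: "x \<notin> bad k n" if "T \<le> n" for n using that by simp
    have const: "(x, u) \<in> stage k n \<longleftrightarrow> (x, u) \<in> stage k T" if "T \<le> n" for n u
      using that
    proof (induction n rule: dec_induct)
      case (step n)
      have "x \<notin> (\<Union>t. changed k n (stage k n) t)" using T[OF step(1)] unfolding bad_def by simp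
      from limit_unchanged[OF this, of u] show ?case using step by simp
    qed simp
    have "(x, u) \<in> final k \<longleftrightarrow> (x, u) \<in> stage k T" for u
    proof
      assume "(x, u) \<in> final k"
      then have "\<exists>n\<ge>T. (x, u) \<in> stage k n" unfolding mem_final_iff by (rule spec)
      then obtain n where "T \<le> n \<and> (x, u) \<in> stage k n" by (rule exE)
      then show "(x, u) \<in> stage k T" using const[of n u] by simp
    next
      assume u: "(x, u) \<in> stage k T"
      have "\<exists>n\<ge>T'. (x, u) \<in> stage k n" for T'
        using const[of "max T T'" u] u by (intro exI[of _ "max T T'"]) simp
      then show "(x, u) \<in> final k" unfolding mem_final_iff by (rule allI)
    qed
    then have "final k `` {x} = stage k T `` {x}" by (intro set_eqI) simp
    then have "x \<in> overfull k (stage k T)" using x by (simp add: overfull_def)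
    then show False using T[of T] unfolding bad_def by simp
  qed
qed

section \<open>Summability of the measures of the bad sets\<close>

lemma overfull_stage_decay:
  assumes \<mu>: "transport \<mu> C" "prob_space \<mu>" and C: "1 \<le> C"
    and a: "\<And>A. A \<in> sets X \<Longrightarrow> (\<integral>\<^sup>+x\<in>A. ecount (G `` {x} \<inter> A) \<partial>\<mu>) \<le> 2 * (a * emeasure \<mu> A)"
  shows "of_nat k ^ n * emeasure \<mu> (overfull k (stage k n)) \<le> (C * a) ^ n"
proof -
  interpret prob_space \<mu> by (rule \<mu>(2))
  show ?thesis
  proof (cases n)
    case 0
    then show ?thesis by (simp add: measure_le_1)
  next
    case (Suc m)
    \<comment> \<open>Stage \<open>Suc m\<close> excludes augmenting paths of length at most
      \<open>m\<close>, and \<open>overfull_decay\<close> reaches one step further, so the exponent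
      is exactly \<open>n\<close>.\<close>
    have na: "no_augmenting k m (stage k n)"
      using no_augmenting_limit[OF oriented_stage] by (simp add: Suc)
    have "of_nat k ^ n * emeasure \<mu> (overfull k (stage k n)) \<le>
        (C * a) ^ n * emeasure \<mu> (reach (stage k n) (overfull k (stage k n)) n)"
      by (rule overfull_decay[OF \<mu>(1) C oriented_stage na a]) (simp_all add: Suc)
    also have "\<dots> \<le> (C * a) ^ n * 1"
      by (intro mult_left_mono measure_le_1) simp
    finally show ?thesis by simp
  qed
qed

text \<open>The overfull sets decay at rate \<open>q\<close>. Alterations at stage \<open>n\<close>
  happen up to \<open>n\<close> steps away and cost a further factor up to \<open>c ^ n\<close>,
  hence the rate \<open>z = c * q\<close>, which is below 1 by the hypothesis on \<open>k\<close>.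
  The factor \<open>Suc n\<close> counts the positions on a walk; the series is the derivative of
  the geometric series.\<close>

lemma limsup_bad_null:
  assumes \<mu>: "transport \<mu> (ennreal c)" "prob_space \<mu>" and c: "1 \<le> c" and a0: "0 \<le> a"
    and a: "\<And>A. A \<in> sets X \<Longrightarrow> (\<integral>\<^sup>+x\<in>A. ecount (G `` {x} \<inter> A) \<partial>\<mu>) \<le> 2 * (ennreal a * emeasure \<mu> A)"
    and k: "c\<^sup>2 * a < real k"
  shows "limsup (bad k) \<in> null_sets \<mu>"
proof -
  interpret prob_space \<mu> by (rule \<mu>(2))
  note s = transport_sets[OF \<mu>(1)]
  have "0 \<le> c\<^sup>2 * a" using a0 by simp
  then have k0: "0 < real k" using k by linarith
  define q where "q = c * a / real k"
  define z where "z = c * q"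
  have q0: "0 \<le> q" unfolding q_def using c a0 by simp
  have z: "0 \<le> z" "z < 1" "q \<le> z"
    unfolding z_def using q0 c k k0 mult_right_mono[OF c q0]
    by (simp_all add: q_def power2_eq_square field_simps)
  have over: "measure \<mu> (overfull k (stage k n)) \<le> q ^ n" for n
  proof -
    have "of_nat k ^ n * emeasure \<mu> (overfull k (stage k n)) \<le> (ennreal c * ennreal a) ^ n"
      using overfull_stage_decay[OF \<mu> _ a] c by simp
    moreover have "of_nat k ^ n * emeasure \<mu> (overfull k (stage k n)) =
        ennreal (real k ^ n * measure \<mu> (overfull k (stage k n)))"
      by (simp add: emeasure_eq_measure ennreal_of_nat_eq_real_of_nat ennreal_power ennreal_mult)
    moreover have "(ennreal c * ennreal a) ^ n = ennreal ((c * a) ^ n)"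
      using c a0 by (simp add: ennreal_power ennreal_mult[symmetric])
    ultimately have "ennreal (real k ^ n * measure \<mu> (overfull k (stage k n))) \<le> ennreal ((c * a) ^ n)"
      by (simp only:)
    then have "real k ^ n * measure \<mu> (overfull k (stage k n)) \<le> (c * a) ^ n"
      using c a0 by (subst (asm) ennreal_le_iff) simp_all
    then show ?thesis
      unfolding q_def power_divide using k0 by (simp add: pos_le_divide_eq mult.commute)
  qed
  have chg: "measure \<mu> (\<Union>t. changed k n (stage k n) t) \<le> real deg * (real (Suc n) * z ^ n)" for n
  proof -
    have "(\<Sum>l\<le>n. ennreal c ^ l) = ennreal (\<Sum>l\<le>n. c ^ l)"
      using c by (simp add: ennreal_power sum_ennreal)
    then have "ennreal (measure \<mu> (\<Union>t. changed k n (stage k n) t)) \<le>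
        ennreal (\<Sum>l\<le>n. c ^ l) * (of_nat deg * ennreal (measure \<mu> (overfull k (stage k n))))"
      using emeasure_changed_le[OF \<mu>(1) oriented_stage, of k n k n] by (simp add: emeasure_eq_measure)
    also have "\<dots> = ennreal ((\<Sum>l\<le>n. c ^ l) * (real deg * measure \<mu> (overfull k (stage k n))))"
      using c by (simp add: ennreal_of_nat_eq_real_of_nat ennreal_mult sum_nonneg)
    finally have "measure \<mu> (\<Union>t. changed k n (stage k n) t) \<le>
        (\<Sum>l\<le>n. c ^ l) * (real deg * measure \<mu> (overfull k (stage k n)))"
      using c by (subst (asm) ennreal_le_iff) (simp_all add: sum_nonneg)
    also have "\<dots> \<le> (real (Suc n) * c ^ n) * (real deg * q ^ n)"
    proof (intro mult_mono)
      have "(\<Sum>l\<le>n. c ^ l) \<le> (\<Sum>l\<le>n. c ^ n)" using c by (intro sum_mono power_increasing) auto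
      then show "(\<Sum>l\<le>n. c ^ l) \<le> real (Suc n) * c ^ n" by simp
    qed (use over c in simp_all)
    also have "\<dots> = real deg * (real (Suc n) * z ^ n)" by (simp add: z_def power_mult_distrib)
    finally show ?thesis .
  qed
  have bad_le: "measure \<mu> (bad k n) \<le> (real deg + 1) * (real (Suc n) * z ^ n)" for n
  proof -
    have "measure \<mu> (bad k n) \<le> measure \<mu> (\<Union>t. changed k n (stage k n) t) + measure \<mu> (overfull k (stage k n))"
      unfolding bad_def
      by (rule measure_Un_le; unfold s;
          intro overfull_sets sets.countable_UN'' changed_sets oriented_stage; simp)
    moreover have "q ^ n \<le> real (Suc n) * z ^ n"
      using power_mono[OF z(3) q0, of n] mult_right_mono[of 1 "real (Suc n)" "z ^ n"] z(1) by simp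
    ultimately show ?thesis using chg[of n] over[of n] by (simp only: distrib_right mult_1)
  qed
  have "summable (\<lambda>n. (real deg + 1) * (real (Suc n) * z ^ n))"
    by (rule summable_mult, rule sums_summable, rule geometric_deriv_sums) (use z in simp)
  then have "summable (\<lambda>n. measure \<mu> (bad k n))"
  proof (rule summable_comparison_test'[of _ 0])
    show "norm (measure \<mu> (bad k n)) \<le> (real deg + 1) * (real (Suc n) * z ^ n)" for n
      using bad_le[of n] by (simp only: real_norm_def abs_of_nonneg[OF measure_nonneg])
  qed
  with _ _ show ?thesis
  proof (rule borel_cantelli_limsup1)
    show "bad k n \<in> sets \<mu>" for n unfolding s by (rule bad_sets)
    show "emeasure \<mu> (bad k n) < \<infinity>" for n by (simp add: emeasure_eq_measure)
  qed
qed

section \<open>Bounds drawn from the cocycle and from \<open>alpha\<close>\<close>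

lemma transport_cocycle_sup:
  assumes \<mu>: "borel_probability X \<mu>" and \<rho>: "radon_nikodym_cocycle X G \<mu> \<rho>"
  shows "transport \<mu> (cocycle_sup X \<rho>)"
  unfolding transport_def
proof (intro conjI allI ballI impI)
  show s: "sets \<mu> = sets X" using \<mu> by (simp add: borel_probability_def)
  fix n A assume A: "A \<in> sets X" "A \<subseteq> Dom n"
  have "\<phi> n \<in> restrict_space X (Dom n) \<rightarrow>\<^sub>M X" by (rule measurable_restrict_space1[OF \<phi>_measurable])
  moreover have "inj_on (\<phi> n) (Dom n)" using \<psi>_\<phi> by (rule inj_on_inverseI)
  ultimately have "borel_partial_injection X (Dom n) (\<phi> n)"
    unfolding borel_partial_injection_def using Dom_sets by blast
  then have "emeasure \<mu> (\<phi> n ` A) = (\<integral>\<^sup>+x\<in>A. ennreal (\<rho> x (\<phi> n x)) \<partial>\<mu>)"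
    using \<rho> A Dom_edge unfolding radon_nikodym_cocycle_def by blast
  also have "\<dots> \<le> (\<integral>\<^sup>+x. cocycle_sup X \<rho> * indicator A x \<partial>\<mu>)"
  proof (rule nn_integral_mono)
    fix x assume "x \<in> space \<mu>"
    then have x: "x \<in> space X" using sets_eq_imp_space_eq[OF s] by simp
    then have "\<phi> n x \<in> space X" using measurable_space[OF \<phi>_measurable] by blast
    then have "ennreal (\<rho> x (\<phi> n x)) \<le> cocycle_sup X \<rho>"
      unfolding cocycle_sup_def by (intro SUP_upper2[OF x] SUP_upper)
    then show "ennreal (\<rho> x (\<phi> n x)) * indicator A x \<le> cocycle_sup X \<rho> * indicator A x"
      by (rule mult_right_mono) simp
  qed
  also have "\<dots> = cocycle_sup X \<rho> * emeasure \<mu> A"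
    by (rule nn_integral_cmult_indicator) (simp add: s A)
  finally show "emeasure \<mu> (\<phi> n ` A) \<le> cocycle_sup X \<rho> * emeasure \<mu> A" .
qed

text \<open>Null sets do not enter the supremum in \<open>alpha\<close>, but for them the integral
  vanishes as well.\<close>

lemma integral_le_alpha:
  assumes \<mu>: "prob_space \<mu>" "sets \<mu> = sets X" and A: "A \<in> sets X"
  shows "(\<integral>\<^sup>+x\<in>A. ecount (G `` {x} \<inter> A) \<partial>\<mu>) \<le> 2 * (alpha X G \<mu> * emeasure \<mu> A)"
proof (cases "emeasure \<mu> A = 0")
  case True
  then have "A \<in> null_sets \<mu>" using A \<mu>(2) by auto
  then show ?thesis by (simp add: nn_integral_null_set)
next
  case False
  interpret prob_space \<mu> by (rule \<mu>(1))
  define I where "I = (\<integral>\<^sup>+x\<in>A. ecount (G `` {x} \<inter> A) \<partial>\<mu>)"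
  define b where "b = 2 * emeasure \<mu> A"
  have b: "b \<noteq> 0" "b \<noteq> top" using False by (simp_all add: b_def ennreal_mult_eq_top_iff)
  have "I / b \<le> alpha X G \<mu>"
    unfolding alpha_def I_def b_def using A False by (intro SUP_upper) (simp add: zero_less_iff_neq_zero)
  then have "b * (I / b) \<le> b * alpha X G \<mu>" by (rule mult_left_mono) simp
  moreover have "b * (I / b) = I"
    using mult_divide_eq_ennreal[OF b, of I] by (simp add: ennreal_times_divide mult.commute)
  ultimately show ?thesis by (simp add: I_def b_def mult_ac)
qed

lemma out_degree_final_sets: "{x \<in> space X. out_degree (final k) x > of_nat k} = overfull k (final k)"
  using finite_section[OF final_sub] by (simp add: overfull_def out_degree_def ecount_finite)

lemma overfull_final_sets: "overfull k (final k) \<in> sets X"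
proof -
  have "(\<lambda>x. card (final k `` {x})) \<in> X \<rightarrow>\<^sub>M count_space UNIV"
    by (rule card_section_measurable[OF final_sets final_sub])
  from measurable_sets[OF this, of "{k<..}"] show ?thesis
    by (simp add: overfull_def vimage_def Int_def conj_commute)
qed

text \<open>The real-valued estimate needs \<open>1 \<le> C\<close> and finite constants. If
  \<open>I = 0\<close>, almost every vertex is isolated and the claim is immediate. Otherwise
  \<open>G\<close> equals its converse, so \<open>transport_converse\<close> gives
  \<open>I \<le> C * I\<close> with \<open>I\<close> positive and finite, whence
  \<open>1 \<le> C\<close>. Moreover \<open>a \<noteq> 0\<close>, which excludes an infinite
  \<open>C\<close>: since \<open>\<infinity> * 0 = 0\<close>, the hypothesis on \<open>k\<close>
  alone would not.\<close>

theorem overfull_final_null: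
  assumes \<mu>: "borel_probability X \<mu>" and \<rho>: "radon_nikodym_cocycle X G \<mu> \<rho>"
    and k: "of_nat k > (cocycle_sup X \<rho>)\<^sup>2 * alpha X G \<mu>"
  shows "overfull k (final k) \<in> null_sets \<mu>"
proof -
  have s: "sets \<mu> = sets X" and prob: "prob_space \<mu>" using \<mu> by (simp_all add: borel_probability_def)
  interpret prob_space \<mu> by (rule prob)
  define C where "C = cocycle_sup X \<rho>"
  define a where "a = alpha X G \<mu>"
  have tr: "transport \<mu> C" unfolding C_def by (rule transport_cocycle_sup[OF \<mu> \<rho>])
  have a_le: "(\<integral>\<^sup>+x\<in>A. ecount (G `` {x} \<inter> A) \<partial>\<mu>) \<le> 2 * (a * emeasure \<mu> A)" if "A \<in> sets X" for A
    unfolding a_def by (rule integral_le_alpha[OF prob s that])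
  have meas: "(\<lambda>x. ecount (G `` {x})) \<in> borel_measurable \<mu>"
    using ecount_section_measurable[OF G_sets order_refl] measurable_cong_sets[OF s refl] by auto
  define I where "I = (\<integral>\<^sup>+x. ecount (G `` {x}) \<partial>\<mu>)"
  show ?thesis
  proof (cases "I = 0")
    case True
    then have null: "emeasure \<mu> {x \<in> space \<mu>. ecount (G `` {x}) \<noteq> 0} = 0"
      using nn_integral_0_iff[OF meas] by (simp add: I_def)
    moreover have "{x \<in> space \<mu>. ecount (G `` {x}) \<noteq> 0} \<in> sets \<mu>"
      using measurable_sets[OF meas, of "- {0}"] by (simp add: vimage_def Int_def conj_commute)
    ultimately have "{x \<in> space \<mu>. ecount (G `` {x}) \<noteq> 0} \<in> null_sets \<mu>" by (simp add: null_setsI)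
    moreover have "overfull k (final k) \<subseteq> {x \<in> space \<mu>. ecount (G `` {x}) \<noteq> 0}"
    proof
      fix x assume x: "x \<in> overfull k (final k)"
      then have "card (final k `` {x}) \<le> card (G `` {x})"
        by (intro card_mono finite_section Image_mono final_sub order_refl)
      then have "card (G `` {x}) \<noteq> 0" using x by (simp add: overfull_def)
      then have "G `` {x} \<noteq> {}" by (intro notI) simp
      then show "x \<in> {x \<in> space \<mu>. ecount (G `` {x}) \<noteq> 0}"
        using x G_degree[of x] by (simp add: overfull_def ecount_finite sets_eq_imp_space_eq[OF s])
    qed
    ultimately show ?thesis
      using null_sets_subset[OF _ overfull_final_sets[of k, folded s]] by blast
  next
    case False
    have "I \<le> (\<integral>\<^sup>+x. of_nat deg \<partial>\<mu>)"
      unfolding I_def using G_degree by (intro nn_integral_mono) (simp add: ecount_finite)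
    then have "I \<le> of_nat deg" by (simp add: emeasure_space_1)
    then have I_fin: "I < top" using of_nat_less_top by (rule le_less_trans)
    have "G\<inverse> = G" using G_sym by (simp add: sym_conv_converse_eq)
    then have "I \<le> C * I"
      using transport_converse[OF tr G_sets order_refl] by (simp add: I_def)
    have C1: "1 \<le> C"
    proof (rule ccontr)
      assume "\<not> 1 \<le> C"
      then have "C < 1" by simp
      moreover have "0 < I" using False by (simp add: zero_less_iff_neq_zero)
      ultimately have "C * I < 1 * I" using I_fin by (rule ennreal_mult_strict_right_mono)
      then show False using \<open>I \<le> C * I\<close> by simp
    qed
    have "I = (\<integral>\<^sup>+x\<in>space X. ecount (G `` {x} \<inter> space X) \<partial>\<mu>)"
      unfolding I_def
    proof (rule nn_integral_cong)
      fix x assume "x \<in> space \<mu>"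
      moreover have "G `` {x} \<inter> space X = G `` {x}" using G_space by blast
      ultimately show "ecount (G `` {x}) = ecount (G `` {x} \<inter> space X) * indicator (space X) x"
        by (simp add: sets_eq_imp_space_eq[OF s])
    qed
    also have "\<dots> \<le> 2 * (a * emeasure \<mu> (space X))" by (rule a_le) simp
    finally have "a \<noteq> 0" using False by auto
    have k': "C\<^sup>2 * a < of_nat k" using k by (simp add: C_def a_def)
    then have "C\<^sup>2 * a < top" using of_nat_less_top by (rule less_trans)
    then have fin: "C\<^sup>2 * a \<noteq> top" by (rule less_imp_neq)
    then have "C \<noteq> top" using \<open>a \<noteq> 0\<close> by (auto simp: power2_eq_square ennreal_mult_eq_top_iff)
    moreover have "a \<noteq> top" using fin C1 by (auto simp: power2_eq_square ennreal_mult_eq_top_iff)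
    ultimately obtain c a' where c: "0 \<le> c" "C = ennreal c" and a': "0 \<le> a'" "a = ennreal a'"
      by (cases C; cases a) simp_all
    have "limsup (bad k) \<in> null_sets \<mu>"
    proof (rule limsup_bad_null[OF _ prob _ a'(1)])
      show "transport \<mu> (ennreal c)" using tr c by simp
      show "1 \<le> c" using C1 c by simp
      show "(\<integral>\<^sup>+x\<in>A. ecount (G `` {x} \<inter> A) \<partial>\<mu>) \<le> 2 * (ennreal a' * emeasure \<mu> A)"
        if "A \<in> sets X" for A
        using a_le[OF that] a' by simp
      have "ennreal (c\<^sup>2 * a') < ennreal (real k)"
        using k' c a' by (simp add: ennreal_power ennreal_mult ennreal_of_nat_eq_real_of_nat)
      then show "c\<^sup>2 * a' < real k" by (simp add: ennreal_less_iff a' c)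
    qed
    then show ?thesis
      by (rule null_sets_subset[OF _ overfull_final_sets[of k, folded s] overfull_final])
  qed
qed

end

theorem mainTheorem1:
  fixes X :: "'a measure" and G :: "('a \<times> 'a) set" and k :: nat
  assumes "standard_borel_space X"
    and "borel_graph X G"
    and "locally_countable X G"
    and "bounded_degree X G"
  shows "\<exists>r. borel_orientation X G r \<and>
    (\<forall>\<mu> \<rho>. borel_probability X \<mu> \<and> quasi_invariant X G \<mu> \<and> radon_nikodym_cocycle X G \<mu> \<rho> \<and>
        of_nat k > (cocycle_sup X \<rho>)\<^sup>2 * alpha X G \<mu> \<longrightarrow>
      {x \<in> space X. out_degree r x > of_nat k} \<in> null_sets \<mu>)"
proof -
  obtain \<phi> \<psi> Dom \<kappa> deg where "enumerated_graph X G \<phi> \<psi> Dom \<kappa> deg"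
    using ex_enumerated_graph[OF assms(1,2,4)] by blast
  then interpret enumerated_graph X G \<phi> \<psi> Dom \<kappa> deg .
  show ?thesis
  proof (intro exI[of _ "final k"] conjI allI impI)
    show "borel_orientation X G (final k)" by (rule borel_orientation_final)
    fix \<mu> \<rho>
    assume "borel_probability X \<mu> \<and> quasi_invariant X G \<mu> \<and> radon_nikodym_cocycle X G \<mu> \<rho> \<and>
      of_nat k > (cocycle_sup X \<rho>)\<^sup>2 * alpha X G \<mu>"
    then show "{x \<in> space X. out_degree (final k) x > of_nat k} \<in> null_sets \<mu>"
      unfolding out_degree_final_sets by (elim conjE) (rule overfull_final_null)
  qed
qed

end
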